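(* Assume that $F(m)m$ is strictly convex on $[a,b]$. Let $\{B^H\}\in\{\{A_1\},\ldots,\{A_l\}\}$ be the information structure that generates the highest equilibrium price among the $1$-separating information structures $\{A_1\},\ldots,\{A_l\}$, and assume that $$S_{\{B^H\}}(B^H,p^M(B^H))\ \ge\ D_{\{B^H\}}(B^H,p^M(B^H)).$$ Then: (i) The set $\mathcal{C}^Q$ is regular. (ii) There exists a $1$-separating information structure $I^*$ such that $(I^*,\boldsymbol{p}^* )=\operatorname{argmax}_{(I,\boldsymbol{p})\in\mathcal{W}^Q}\pi^Q(I,\boldsymbol{p})$. That is, there exists a $1$-separating information structure $I^*$ that maximizes the platform's revenue. (iii) The pair $(I^*,\boldsymbol{p}^* )$ induces a menu that is maximal in $\mathcal{C}^Q_1$, and $B^*\in I_o=\{A_1,\ldots,A_l\}$, where $I^*=\{B^*\}$ is the optimal information structure.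
   Context: Sellers and information. Sellers' quality levels lie in $X=[0,\overline{x}]$, $\overline{x}>0$, and are distributed according to a Borel probability measure $\phi$ on $X$. The platform's information is a finite measurable partition $I_o=\{A_1,\ldots,A_l\}$ of $X$ with $\phi(A_i)>0$ for all $i$. An information structure is a family $I=\{B_1,\ldots,B_n\}$ of disjoint sets, each of which is a union of elements of $I_o$; it is $k$-separating if it has exactly $k$ elements. A pricing function for $I$ is a vector $\boldsymbol{p}=(p(B_1),\ldots,p(B_n))$, where $p(B_i)$ is the price charged by every seller in $B_i$; it is positive if all $p(B_i)>0$. Supply. Fix $\alpha>0$ and a measurable function $k$ on $X$ bounded below by a positive number. A type $x\in B_i$ seller chooses $g(x,p(B_i))=\operatorname{argmax}_{h\ge0}\left[h\,p(B_i)-k(x)h^{\alpha+1}/(\alpha+1)\right]$. The supply is $S_I(B_i,p(B_i))=\int_{B_i}g(x,p(B_i))\,\phi(dx)$. Demand. Buyers' types $m$ are distributed according to a distribution function $F$ with continuous density, supported on $[a,b]\subseteq[0,\infty)$. Given beliefs $\lambda_{B_i}$ (a probability measure describing the quality of sellers in $B_i$) with mean $\mathbb{E}_{\lambda_{B_i}}(X)$, a type $m$ buyer's utility from buying in $B_i$ is $Z(m,B_i,p(B_i))=m\,\mathbb{E}_{\lambda_{B_i}}(X)-p(B_i)$, and not buying gives $0$. Demand is $D_I(B_i,\boldsymbol{p})=\int_a^b1\{Z(m,B_i,p(B_i))\ge0\}\,1\{Z(m,B_i,p(B_i))=\max_{B\in I}Z(m,B,p(B))\}\,F(dm)$, ties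 being broken in favor of the set with the highest index. Beliefs. Beliefs are consistent with sellers' decisions: $\lambda_{B_i}(A)=\int_A g(x,p(B_i))\phi(dx)\big/\int_{B_i}g(x,p(B_i))\phi(dx)$ for measurable $A\subseteq B_i$ (the Dirac measure at $0$ if the denominator vanishes). For positive prices the mean does not depend on the prices: $\mathbb{E}_{\lambda_B}(X)=\int_Bxk(x)^{-1/\alpha}\phi(dx)/\int_Bk(x)^{-1/\alpha}\phi(dx)$. It is assumed throughout that $\mathbb{E}_{\lambda_{A_1}}(X)<\cdots<\mathbb{E}_{\lambda_{A_l}}(X)$. Equilibrium. For $I$ and a positive pricing function $\boldsymbol{p}$, an equilibrium consists of the demands, the supplies and the beliefs above (sellers' and buyers' decisions optimal, beliefs consistent) such that markets clear: $S_I(B_i,p(B_i))=D_I(B_i,\boldsymbol{p})$ for all $B_i\in I$. The pair $(I,\boldsymbol{p})$ is implementable if an equilibrium under it exists; $\mathcal{W}^Q$ is the set of implementable pairs. For each $I$ there is at most one $\boldsymbol p$ such that $(I,\boldsymbol p)$ is implementable; for a $1$-separating $\{B\}$ this price $p(B)$ is its equilibrium price. Thus $B^H\in\{A_1,\ldots,A_l\}$ is such that $p(B^H)\ge p(B)$ for the equilibrium prices of all $B\in\{A_1,\ldots,A_l\}$. Further, $p^M(B)=\operatorname{argmax}_{p\ge0}p\,(1-F(p/\mathbb{E}_{\lambda_B}(X)))$. Revenue and menus. Revenue is $\pi^Q(I,\boldsymbol{p})=\sum_{B_i\in I}p(B_i)\min\{D_I(B_i,\boldsymbol{p}),S_I(B_i,p(B_i))\}$.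 An implementable $(I,\boldsymbol{p})$ induces the menu $\{(p(B_i),\mathbb{E}_{\lambda_{B_i}}(X)):B_i\in I\}$ of price-quality pairs; an information structure is optimal if it induces a menu that maximizes the platform's revenue. $\mathcal{C}^Q$ is the set of all menus induced by implementable pairs, and $\mathcal{C}^Q_1\subseteq\mathcal{C}^Q$ is the set of its one-pair ($1$-separating) menus. A menu $\{(p,q)\}\in\mathcal{C}^Q_1$ is maximal in $\mathcal{C}^Q_1$ if for every $\{(p',q')\}\in\mathcal{C}^Q_1$ with $(p',q')\ne(p,q)$ we have $p>p'$ or $q>q'$. Regularity. For a set $\mathcal{C}$ of menus, write $\mathcal{C}_p$ for the menus in $\mathcal{C}$ each of whose pairs is chosen by a positive mass of buyers (a type $m$ buyer maximizes $mq-p$ over the menu and buys if this is $\ge0$), $\mathcal{C}_1$ for the one-pair menus in $\mathcal{C}_p$, and $p^M(q)=\inf\operatorname{argmax}_{p\ge0}p(1-F(p/q))$. $\mathcal{C}$ is regular if: (i) whenever $\{(p_1,q_1),\ldots,(p_k,q_k)\}\in\mathcal{C}_p$ with $p_1\le\cdots\le p_k$, there exists $\{(p,q)\}\in\mathcal{C}_1$ with $p\ge p_k$ and $q\ge q_k$; (ii) if $\{(p,q)\}\in\mathcal{C}_1$ satisfies $p\ge p'$ for all $\{(p',q')\}\in\mathcal{C}_1$, then $p\le p^M(q)$.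
   Formalization: If several A_i tie for the highest equilibrium price, the inequality S ≥ D at p^M is assumed for every such A_i, not just for one chosen B^H; with it for only one of them, part (i) (regularity of C^Q) can fail. *)

theory Defs
  imports "HOL-Probability.Probability"
begin

section \<open>The market\<close>

text \<open>
  Information sets are sets of reals inside \<open>[0, xbar]\<close>.  The partition and every information
  structure are lists of sets: the position in the list is the index of a set, which the
  tie-breaking rule of the buyers refers to.  A pricing function is a list of reals of the same
  length, giving the price of each set.
\<close>

record market =
  xbar :: real
  sellers :: "real measure"
  parts :: "real set list"
  elasticity :: real
  cost :: "real \<Rightarrow> real"
  lo :: real
  hi :: real
  buyers :: "real measure"

definition type_cdf :: "market \<Rightarrow> real \<Rightarrow> real" where
  "type_cdf E = cdf (buyers E)"


section \<open>Supply\<close>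

definition seller_choice :: "market \<Rightarrow> real \<Rightarrow> real \<Rightarrow> real" where
  "seller_choice E x p = (ARG_MAX (\<lambda>h. h * p - cost E x * h powr (elasticity E + 1) / (elasticity E + 1)) h. 0 \<le> h)"

definition supply_of :: "market \<Rightarrow> real set \<Rightarrow> real \<Rightarrow> real" where
  "supply_of E B p = (LINT x:B|sellers E. seller_choice E x p)"


section \<open>Beliefs\<close>

definition belief :: "market \<Rightarrow> real set \<Rightarrow> real \<Rightarrow> real measure" where
  "belief E B p =
     (if supply_of E B p = 0 then return (sellers E) 0
      else density (sellers E) (\<lambda>x. ennreal (indicator B x * seller_choice E x p / supply_of E B p)))"

definition mean_quality :: "market \<Rightarrow> real set \<Rightarrow> real \<Rightarrow> real" where
  "mean_quality E B p = (LINT x|belief E B p. x)"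

text \<open>
  The value of \<^term>\<open>mean_quality E B p\<close> for every \<open>p > 0\<close>, see \<open>mean_quality_eq\<close> below.
\<close>

definition quality :: "market \<Rightarrow> real set \<Rightarrow> real" where
  "quality E B =
     (LINT x:B|sellers E. x * cost E x powr (- 1 / elasticity E)) /
     (LINT x:B|sellers E. cost E x powr (- 1 / elasticity E))"


section \<open>Standing assumptions\<close>

text \<open>
  The density of the buyers' types is continuous on \<open>[a, b]\<close>, not on the whole line: for instance
  the uniform distribution is allowed.
\<close>

definition quality_market :: "market \<Rightarrow> bool" where
  "quality_market E \<longleftrightarrow>
     0 < xbar E \<and>
     prob_space (sellers E) \<and>
     sets (sellers E) = sets (restrict_space borel {0..xbar E}) \<and>
     distinct (parts E) \<and>
     partition_on {0..xbar E} (set (parts E)) \<and>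
     (\<forall>A\<in>set (parts E). A \<in> sets (sellers E) \<and> 0 < measure (sellers E) A) \<and>
     0 < elasticity E \<and>
     cost E \<in> borel_measurable (sellers E) \<and>
     (\<exists>c>0. \<forall>x\<in>{0..xbar E}. c \<le> cost E x) \<and>
     0 \<le> lo E \<and> lo E < hi E \<and>
     prob_space (buyers E) \<and>
     (\<exists>f. continuous_on {lo E..hi E} f \<and> (\<forall>m\<in>{lo E..hi E}. 0 \<le> f m) \<and>
        buyers E = density lborel (\<lambda>m. ennreal (f m) * indicator {lo E..hi E} m)) \<and>
     sorted_wrt (\<lambda>A A'. quality E A < quality E A') (parts E)"

lemma powr_Bernoulli_strict:
  fixes s t :: real
  assumes "1 < s" "0 \<le> t" "t \<noteq> 1"
  shows "t - t powr s / s < 1 - 1 / s"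
proof -
  define f where "f = (\<lambda>t::real. t - t powr s / s)"
  have d: "(f has_real_derivative 1 - t powr (s - 1)) (at t)" if "0 < t" for t
    unfolding f_def using that assms(1) by (auto intro!: derivative_eq_intros)
  have c: "continuous_on {0..} f"
    unfolding f_def using assms(1) by (intro continuous_intros continuous_on_powr') auto
  consider "t < 1" | "1 < t" using assms by linarith
  then have "f t < f 1"
  proof cases
    case 1
    show ?thesis
    proof (rule DERIV_pos_imp_increasing_open[OF 1])
      fix x assume x: "t < x" "x < 1"
      then have "x powr (s - 1) < 1 powr (s - 1)"
        using assms by (intro powr_less_mono2) auto
      then show "\<exists>y. (f has_real_derivative y) (at x) \<and> 0 < y"
        using d[of x] x assms by auto
    qed (rule continuous_on_subset[OF c], use assms in auto)
  next
    case 2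
    show ?thesis
    proof (rule DERIV_neg_imp_decreasing_open[OF 2])
      fix x assume x: "1 < x" "x < t"
      then have "1 powr (s - 1) < x powr (s - 1)"
        using assms by (intro powr_less_mono2) auto
      then show "\<exists>y. (f has_real_derivative y) (at x) \<and> y < 0"
        using d[of x] x by auto
    qed (rule continuous_on_subset[OF c], auto)
  qed
  then show ?thesis by (simp add: f_def)
qed

lemma seller_choice_eq:
  assumes "0 < elasticity E" "0 < cost E x" "0 < p"
  shows "seller_choice E x p = p powr (1 / elasticity E) * cost E x powr (- 1 / elasticity E)"
proof -
  define a k h0 where "a = elasticity E" and "k = cost E x"
    and "h0 = p powr (1 / a) * k powr (- 1 / a)"
  define u where "u = (\<lambda>h. h * p - k * h powr (a + 1) / (a + 1))"
  have a: "0 < a" and k: "0 < k" using assms by (auto simp: a_def k_def)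
  have h0: "0 < h0" using k assms by (simp add: h0_def)
  have "h0 powr a = p * k powr (-1)"
    using a k assms by (simp add: h0_def powr_mult powr_powr)
  then have p: "p = k * h0 powr a"
    using k by (simp add: powr_minus field_simps)
  have u_eq: "u (h0 * t) = p * h0 * (t - t powr (a + 1) / (a + 1))" if "0 \<le> t" for t
  proof -
    have "k * (h0 * t) powr (a + 1) = p * h0 * t powr (a + 1)"
      using that h0 by (simp add: powr_mult p powr_add)
    then show ?thesis by (simp add: u_def algebra_simps)
  qed
  have lt: "u h < u h0" if "0 \<le> h" "h \<noteq> h0" for h
  proof -
    have "h / h0 - (h / h0) powr (a + 1) / (a + 1) < 1 - 1 / (a + 1)"
      using a that h0 by (intro powr_Bernoulli_strict) auto
    then have "p * h0 * (h / h0 - (h / h0) powr (a + 1) / (a + 1)) < p * h0 * (1 - 1 / (a + 1))"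
      using assms h0 by (intro mult_strict_left_mono) auto
    then show ?thesis using u_eq[of "h / h0"] u_eq[of 1] h0 that by simp
  qed
  have "(ARG_MAX u h. 0 \<le> h) = h0"
    unfolding arg_max_def
  proof (rule some_equality)
    show "is_arg_max u ((\<le>) 0) h0"
      using lt h0 by (fastforce simp: is_arg_max_def)
    show "h = h0" if "is_arg_max u ((\<le>) 0) h" for h
      using that lt[of h] h0 by (fastforce simp: is_arg_max_def)
  qed
  then show ?thesis
    by (simp add: seller_choice_def u_def h0_def a_def k_def)
qed

lemma mean_quality_eq:
  assumes E: "quality_market E" and B: "B \<in> sets (sellers E)" and p: "0 < p"
  shows "mean_quality E B p = quality E B"
proof -
  define c w where "c = p powr (1 / elasticity E)"
    and "w = (\<lambda>x. cost E x powr (- 1 / elasticity E))"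
  have [measurable]: "cost E \<in> borel_measurable (sellers E)" "B \<in> sets (sellers E)"
    and a: "0 < elasticity E" and sets: "sets (sellers E) = sets (restrict_space borel {0..xbar E})"
    and prob: "prob_space (sellers E)" and xb: "0 < xbar E"
    using E B by (auto simp: quality_market_def)
  have sp: "space (sellers E) = {0..xbar E}"
    using sets_eq_imp_space_eq[OF sets] by (simp add: space_restrict_space)
  have id: "(\<lambda>x. x) \<in> borel_measurable (sellers E)"
    unfolding measurable_cong_sets[OF sets refl] by (intro measurable_restrict_space1) simp
  obtain d where d: "0 < d" "\<And>x. x \<in> {0..xbar E} \<Longrightarrow> d \<le> cost E x"
    using E by (auto simp: quality_market_def)
  have c: "0 < c" using p by (simp add: c_def)
  have sc: "seller_choice E x p = c * w x" if "x \<in> B" for x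
    using that sets.sets_into_space[OF B] sp d(1) d(2)[of x] a p
    by (subst seller_choice_eq) (force simp: c_def w_def)+
  have [measurable]: "w \<in> borel_measurable (sellers E)" by (simp add: w_def)
  have w0: "0 \<le> w x" for x by (simp add: w_def)
  have S: "supply_of E B p = c * (LINT x:B|sellers E. w x)"
    unfolding supply_of_def using sc
    by (subst set_lebesgue_integral_cong[where g = "\<lambda>x. c * w x"]) auto
  have Q: "quality E B = (LINT x:B|sellers E. x * w x) / (LINT x:B|sellers E. w x)"
    by (simp add: quality_def w_def)
  show ?thesis
  proof (cases "(LINT x:B|sellers E. w x) = 0")
    case True
    have "mean_quality E B p = (LINT x|return (sellers E) (0::real). x)"
      using True by (simp add: mean_quality_def belief_def S)
    also have "\<dots> = 0"
      using id xb sp by (subst integral_return) auto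
    finally show ?thesis using True by (simp add: Q)
  next
    case False
    define W where "W = (LINT x:B|sellers E. w x)"
    have W: "0 < W"
      using False w0 unfolding W_def set_lebesgue_integral_def
      by (metis (no_types, lifting) Bochner_Integration.integral_nonneg indicator_pos_le
          less_eq_real_def scaleR_nonneg_nonneg)
    have S': "supply_of E B p = c * W" using S by (simp add: W_def)
    have eq: "indicator B x * seller_choice E x p / supply_of E B p = indicator B x * w x / W" for x
      using sc[of x] c by (auto simp: indicator_def S')
    have "belief E B p = density (sellers E) (\<lambda>x. ennreal (indicator B x * w x / W))"
      using W c by (simp add: belief_def eq) (simp add: S')
    then have "mean_quality E B p = (LINT x|sellers E. (indicator B x * w x / W) * x)"
      using id W w0 by (simp add: mean_quality_def integral_density)
    also have "\<dots> = (LINT x|sellers E. (indicator B x * (x * w x)) / W)"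
      by (intro Bochner_Integration.integral_cong) auto
    also have "\<dots> = quality E B"
      by (simp add: Q W_def set_lebesgue_integral_def)
    finally show ?thesis .
  qed
qed

definition strictly_convex_on :: "real set \<Rightarrow> (real \<Rightarrow> real) \<Rightarrow> bool" where
  "strictly_convex_on S h \<longleftrightarrow>
     (\<forall>x\<in>S. \<forall>y\<in>S. \<forall>t. x \<noteq> y \<and> 0 < t \<and> t < 1 \<longrightarrow>
        h ((1 - t) * x + t * y) < (1 - t) * h x + t * h y)"


section \<open>Information structures, demand and equilibrium\<close>

definition info_structure :: "market \<Rightarrow> real set list \<Rightarrow> bool" where
  "info_structure E I \<longleftrightarrow>
     I \<noteq> [] \<and> distinct I \<and> disjoint (set I) \<and>
     (\<forall>B\<in>set I. \<exists>\<A>. \<A> \<noteq> {} \<and> \<A> \<subseteq> set (parts E) \<and> B = \<Union>\<A>)"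

definition separating :: "market \<Rightarrow> nat \<Rightarrow> real set list \<Rightarrow> bool" where
  "separating E n I \<longleftrightarrow> info_structure E I \<and> length I = n"

definition buyer_utility :: "market \<Rightarrow> real \<Rightarrow> real set \<Rightarrow> real \<Rightarrow> real" where
  "buyer_utility E m B p = m * mean_quality E B p - p"

definition demand_of :: "market \<Rightarrow> real set list \<Rightarrow> real list \<Rightarrow> nat \<Rightarrow> real" where
  "demand_of E I p i =
     (LINT m:{lo E..hi E}|buyers E.
        of_bool (0 \<le> buyer_utility E m (I ! i) (p ! i)) *
        of_bool (buyer_utility E m (I ! i) (p ! i) = (MAX j\<in>{..<length I}. buyer_utility E m (I ! j) (p ! j)) \<and>
                 (\<forall>j. i < j \<and> j < length I \<longrightarrow> buyer_utility E m (I ! j) (p ! j) \<noteq> buyer_utility E m (I ! i) (p ! i))))"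

definition implementable :: "market \<Rightarrow> real set list \<Rightarrow> real list \<Rightarrow> bool" where
  "implementable E I p \<longleftrightarrow>
     info_structure E I \<and> length p = length I \<and> (\<forall>i<length I. 0 < p ! i) \<and>
     (\<forall>i<length I. supply_of E (I ! i) (p ! i) = demand_of E I p i)"

definition WQ :: "market \<Rightarrow> (real set list \<times> real list) set" where
  "WQ E = {(I, p). implementable E I p}"

definition revenue :: "market \<Rightarrow> real set list \<Rightarrow> real list \<Rightarrow> real" where
  "revenue E I p = (\<Sum>i<length I. p ! i * min (demand_of E I p i) (supply_of E (I ! i) (p ! i)))"

text \<open>
  Several elements of the partition may share the highest equilibrium price (with different mean
  qualities), so the following predicate need not determine \<open>B\<close>.
\<close>

definition highest_price :: "market \<Rightarrow> real set \<Rightarrow> bool" where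
  "highest_price E B \<longleftrightarrow>
     B \<in> set (parts E) \<and>
     (\<exists>p. ([B], [p]) \<in> WQ E \<and> (\<forall>B'\<in>set (parts E). \<forall>p'. ([B'], [p']) \<in> WQ E \<longrightarrow> p' \<le> p))"


section \<open>Monopoly prices\<close>

definition monopoly_price :: "market \<Rightarrow> real set \<Rightarrow> real" where
  "monopoly_price E B = (ARG_MAX (\<lambda>p. p * (1 - type_cdf E (p / quality E B))) p. 0 \<le> p)"

definition pM :: "market \<Rightarrow> real \<Rightarrow> real" where
  "pM E q = Inf {p. is_arg_max (\<lambda>p. p * (1 - type_cdf E (p / q))) (\<lambda>p. 0 \<le> p) p}"


section \<open>Menus\<close>

type_synonym menu = "(real \<times> real) set"

definition induced_menu :: "market \<Rightarrow> real set list \<Rightarrow> real list \<Rightarrow> menu" where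
  "induced_menu E I p = (\<lambda>i. (p ! i, mean_quality E (I ! i) (p ! i))) ` {..<length I}"

definition CQ :: "market \<Rightarrow> menu set" where
  "CQ E = (\<lambda>(I, p). induced_menu E I p) ` WQ E"

definition one_pair :: "menu set \<Rightarrow> menu set" where
  "one_pair C = {M \<in> C. \<exists>p q. M = {(p, q)}}"

definition maximal_menu :: "menu set \<Rightarrow> menu \<Rightarrow> bool" where
  "maximal_menu C M \<longleftrightarrow>
     (\<exists>p q. M = {(p, q)} \<and> M \<in> C \<and>
        (\<forall>p' q'. {(p', q')} \<in> C \<and> (p', q') \<noteq> (p, q) \<longrightarrow> p > p' \<or> q > q'))"

definition chosen_by :: "market \<Rightarrow> menu \<Rightarrow> real \<times> real \<Rightarrow> real set" where
  "chosen_by E M = (\<lambda>(p, q).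
     {m \<in> {lo E..hi E}. 0 \<le> m * q - p \<and> (\<forall>(p', q')\<in>M. m * q' - p' \<le> m * q - p)})"

definition positive_mass :: "market \<Rightarrow> menu set \<Rightarrow> menu set" where
  "positive_mass E C = {M \<in> C. \<forall>z\<in>M. 0 < measure (buyers E) (chosen_by E M z)}"

definition regular :: "market \<Rightarrow> menu set \<Rightarrow> bool" where
  "regular E C \<longleftrightarrow>
     (\<forall>zs. zs \<noteq> [] \<and> sorted (map fst zs) \<and> set zs \<in> positive_mass E C \<longrightarrow>
        (\<exists>p q. {(p, q)} \<in> one_pair (positive_mass E C) \<and> fst (last zs) \<le> p \<and> snd (last zs) \<le> q)) \<and>
     (\<forall>p q. {(p, q)} \<in> one_pair (positive_mass E C) \<and>
        (\<forall>p' q'. {(p', q')} \<in> one_pair (positive_mass E C) \<longrightarrow> p' \<le> p) \<longrightarrow> p \<le> pM E q)"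

end

theory Submission
  imports Defs
begin

text \<open>
  Put \<open>R m = m (1 - F m)\<close>.  Strict convexity of \<open>F m * m\<close> makes \<open>R\<close> concave with a unique maximizer
  \<open>peak\<close>, so the monopoly price for quality \<open>q\<close> is \<open>peak * q\<close> and a single price below it earns more
  when price and quality both rise.  The revenue of a menu with several pairs is at most what its
  highest-priced pair \<open>(p, q)\<close> would earn alone at demand \<open>1 - F (p / q)\<close>, by summation by parts and
  Jensen's inequality; the equilibrium price of that pair's set alone is at least \<open>p\<close>.  Finally, in
  any union of several elements of the partition one of them has at least the mean quality and less supply,
  hence a higher equilibrium price, and the supply assumption on \<open>B\<^sup>H\<close> keeps the prices that matter
  below the monopoly price.
\<close>

section \<open>The market and its notation\<close>

locale goods_market =
  fixes E :: market
  assumes market: "quality_market E"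
begin

abbreviation F :: "real \<Rightarrow> real" where "F \<equiv> type_cdf E"
abbreviation q :: "real set \<Rightarrow> real" where "q \<equiv> quality E"

text \<open>By \<open>seller_choice_eq\<close> this is what a seller of type \<open>x\<close>
  supplies at price 1. Hence \<open>W B\<close> is the supply of \<open>B\<close> at price 1, and
  \<open>quality\<close> is a mean weighted by \<open>w\<close>.\<close>

definition w :: "real \<Rightarrow> real" where "w x = cost E x powr (- 1 / elasticity E)"
definition W :: "real set \<Rightarrow> real" where "W B = (LINT x:B|sellers E. w x)"

text \<open>Revenue per unit of quality at the price \<open>m\<close> per unit of quality.\<close>

definition R :: "real \<Rightarrow> real" where "R m = m * (1 - F m)"

lemma lo_nonneg: "0 \<le> lo E" and lo_less_hi: "lo E < hi E" and hi_pos: "0 < hi E"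
  using market by (auto simp: quality_market_def)

sublocale buyers: real_distribution "buyers E"
proof -
  have "prob_space (buyers E)" and "\<exists>f. buyers E = density lborel f"
    using market unfolding quality_market_def by blast+
  then show "real_distribution (buyers E)"
    by (auto simp: real_distribution_def real_distribution_axioms_def)
qed

sublocale sellers: prob_space "sellers E"
  using market by (simp add: quality_market_def)

subsection \<open>The distribution of buyers\<close>

text \<open>The types have a Lebesgue density that vanishes outside \<open>[lo E, hi E]\<close>.
  This excludes atoms, which makes \<open>F\<close> continuous, and fixes \<open>F\<close> beyond
  both ends.\<close>

lemma buyers_null:
  assumes "A \<in> sets borel" "emeasure lborel (A \<inter> {lo E..hi E}) = 0"
  shows "measure (buyers E) A = 0"
proof -
  obtain f where f: "continuous_on {lo E..hi E} f"
    and b: "buyers E = density lborel (\<lambda>m. ennreal (f m) * indicator {lo E..hi E} m)"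
    using market unfolding quality_market_def by blast
  \<comment> \<open>Nothing is known of \<open>f\<close> outside the interval, so measurability is
    proved for its product with the indicator.\<close>
  have "(\<lambda>m. f m * indicator {lo E..hi E} m) \<in> borel_measurable borel"
    using borel_measurable_continuous_on_indicator[OF _ f]
    by (simp add: mult.commute)
  then have "(\<lambda>m. ennreal (f m * indicator {lo E..hi E} m)) \<in> borel_measurable borel" by measurable
  moreover have "(\<lambda>m. ennreal (f m * indicator {lo E..hi E} m))
      = (\<lambda>m. ennreal (f m) * indicator {lo E..hi E} m)"
    by (auto simp: indicator_def)
  ultimately have meas: "(\<lambda>m. ennreal (f m) * indicator {lo E..hi E} m) \<in> borel_measurable lborel"
    by simp
  have "AE m in lborel. m \<notin> A \<inter> {lo E..hi E}"
    using assms by (intro AE_not_in) (auto simp: null_sets_def)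
  then have "AE m in lborel. m \<in> A \<longrightarrow> ennreal (f m) * indicator {lo E..hi E} m = 0"
    by eventually_elim (auto simp: indicator_def)
  then have "AE m in lborel. (ennreal (f m) * indicator {lo E..hi E} m) * indicator A m = 0"
    by eventually_elim (auto simp: indicator_def)
  moreover have "emeasure (buyers E) A =
      (\<integral>\<^sup>+m. (ennreal (f m) * indicator {lo E..hi E} m) * indicator A m \<partial>lborel)"
    unfolding b using assms(1) meas by (intro emeasure_density) auto
  moreover have "(\<lambda>m. (ennreal (f m) * indicator {lo E..hi E} m) * indicator A m) \<in> borel_measurable lborel"
    using borel_measurable_times_ennreal[OF meas borel_measurable_indicator] assms(1) by simp
  ultimately have "emeasure (buyers E) A = 0"
    by (subst (asm) nn_integral_0_iff_AE[symmetric]) auto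
  then show ?thesis by (simp add: measure_def)
qed

lemma isCont_F: "isCont F x"
  unfolding type_cdf_def buyers.isCont_cdf
  by (rule buyers_null) (auto intro!: emeasure_lborel_countable)

lemma F_cont: "continuous_on S f \<Longrightarrow> continuous_on S (\<lambda>x. F (f x))"
  by (rule continuous_on_compose2[of UNIV F S f]) (auto simp: continuous_at_imp_continuous_on isCont_F)

lemma F_mono: "x \<le> y \<Longrightarrow> F x \<le> F y"
  by (simp add: type_cdf_def buyers.cdf_nondecreasing)

lemma F_nonneg: "0 \<le> F x"
  by (simp add: type_cdf_def buyers.cdf_nonneg)

lemma F_lo: "x \<le> lo E \<Longrightarrow> F x = 0"
proof -
  assume "x \<le> lo E"
  then have "countable ({..x} \<inter> {lo E..hi E})"
    by - (rule countable_subset[of _ "{lo E}"], auto)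
  then show ?thesis
    unfolding type_cdf_def cdf_def by (intro buyers_null emeasure_lborel_countable) auto
qed

text \<open>The cutoff type still buys, so demand is the mass of a closed half-line; its endpoint
  has mass 0.\<close>

lemma measure_atLeast: "measure (buyers E) {x..} = 1 - F x"
proof -
  have "measure (buyers E) {x..} = measure (buyers E) ({x<..} \<union> {x})"
    by (rule arg_cong[where f = "measure (buyers E)"]) auto
  also have "\<dots> = measure (buyers E) {x<..} + measure (buyers E) {x}"
    by (intro buyers.finite_measure_Union) auto
  also have "measure (buyers E) {x} = 0"
    by (rule buyers_null) (auto intro!: emeasure_lborel_countable)
  also have "measure (buyers E) {x<..} = 1 - F x"
  proof -
    have "{x<..} = space (buyers E) - {..x}" by auto
    then show ?thesis
      using buyers.prob_compl[of "{..x}"] by (simp add: type_cdf_def cdf_def)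
  qed
  finally show ?thesis by simp
qed

lemma F_hi:
  assumes "hi E \<le> x"
  shows "F x = 1"
proof -
  have "countable ({x..} \<inter> {lo E..hi E})"
    using assms by - (rule countable_subset[of _ "{hi E}"], auto)
  then have "measure (buyers E) {x..} = 0"
    by (intro buyers_null emeasure_lborel_countable) auto
  then show ?thesis using measure_atLeast[of x] by simp
qed

subsection \<open>Supply and quality\<close>

lemma sellers_space: "space (sellers E) = {0..xbar E}"
  using market sets_eq_imp_space_eq[of "sellers E" "restrict_space borel {0..xbar E}"]
  by (simp add: quality_market_def space_restrict_space)

lemma elasticity_pos: "0 < elasticity E"
  using market by (simp add: quality_market_def)

lemma cost_pos: "x \<in> {0..xbar E} \<Longrightarrow> 0 < cost E x"
  using market unfolding quality_market_def by fastforce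

lemma w_pos: "x \<in> {0..xbar E} \<Longrightarrow> 0 < w x"
  using cost_pos[of x] by (simp add: w_def)

lemma w_nonneg: "0 \<le> w x"
  by (simp add: w_def)

lemma w_measurable [measurable]: "w \<in> borel_measurable (sellers E)"
proof -
  have [measurable]: "cost E \<in> borel_measurable (sellers E)"
    using market by (simp add: quality_market_def)
  show ?thesis unfolding w_def by measurable
qed

lemma id_measurable: "(\<lambda>x. x) \<in> borel_measurable (sellers E)"
proof -
  have "sets (sellers E) = sets (restrict_space borel {0..xbar E})"
    using market by (simp add: quality_market_def)
  then show ?thesis
    unfolding measurable_cong_sets[OF \<open>sets (sellers E) = _\<close> refl]
    by (intro measurable_restrict_space1) simp
qed

text \<open>The cost is bounded below by a positive number and enters with a negative exponent.
  Boundedness is what makes \<open>w\<close> integrable.\<close>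

lemma w_bounded: "\<exists>C. \<forall>x\<in>{0..xbar E}. w x \<le> C"
proof -
  obtain c where c: "0 < c" "\<And>x. x \<in> {0..xbar E} \<Longrightarrow> c \<le> cost E x"
    using market unfolding quality_market_def by blast
  have "w x \<le> c powr (- 1 / elasticity E)" if "x \<in> {0..xbar E}" for x
    unfolding w_def using c(1) c(2)[OF that] elasticity_pos by (intro powr_mono2') auto
  then show ?thesis by blast
qed

lemma w_integrable: "B \<in> sets (sellers E) \<Longrightarrow> set_integrable (sellers E) B w"
  and xw_integrable: "B \<in> sets (sellers E) \<Longrightarrow> set_integrable (sellers E) B (\<lambda>x. x * w x)"
proof -
  assume B: "B \<in> sets (sellers E)"
  note [measurable] = id_measurable B
  obtain C0 where "\<And>x. x \<in> {0..xbar E} \<Longrightarrow> w x \<le> C0" using w_bounded by blast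
  then have C: "\<And>x. x \<in> {0..xbar E} \<Longrightarrow> w x \<le> \<bar>C0\<bar>" by fastforce
  have sub: "B \<subseteq> {0..xbar E}" using sets.sets_into_space[OF B] sellers_space by simp
  show "set_integrable (sellers E) B w" unfolding set_integrable_def
    by (rule sellers.integrable_const_bound[where B = "\<bar>C0\<bar>"])
      (use C w_nonneg sellers_space in \<open>auto simp: indicator_def intro!: AE_I2 intro: order_trans\<close>)
  have "\<bar>x * w x\<bar> \<le> xbar E * \<bar>C0\<bar>" if "x \<in> {0..xbar E}" for x
    using that C[OF that] w_nonneg[of x] by (auto simp: abs_mult intro!: mult_mono)
  moreover have "0 \<le> xbar E * \<bar>C0\<bar>"
    using market by (simp add: quality_market_def)
  ultimately show "set_integrable (sellers E) B (\<lambda>x. x * w x)" unfolding set_integrable_def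
    by (intro sellers.integrable_const_bound[where B = "xbar E * \<bar>C0\<bar>"])
      (use sub in \<open>auto simp: indicator_def intro!: AE_I2\<close>)
qed

text \<open>The optimal quantity is a price factor times \<open>w x\<close>, so a set enters its
  supply only through the number \<open>W B\<close>.\<close>

lemma supply_eq:
  assumes B: "B \<in> sets (sellers E)" and p: "0 < p"
  shows "supply_of E B p = p powr (1 / elasticity E) * W B"
proof -
  have sub: "B \<subseteq> {0..xbar E}" using sets.sets_into_space[OF B] sellers_space by simp
  have "supply_of E B p = (LINT x:B|sellers E. p powr (1 / elasticity E) * w x)"
    unfolding supply_of_def
    using sub cost_pos elasticity_pos p
    by (intro set_lebesgue_integral_cong B) (auto simp: w_def seller_choice_eq)
  then show ?thesis by (simp add: W_def)
qed

lemma W_pos: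
  assumes B: "B \<in> sets (sellers E)" and "0 < measure (sellers E) B"
  shows "0 < W B"
proof -
  have sub: "B \<subseteq> {0..xbar E}" using sets.sets_into_space[OF B] sellers_space by simp
  have nn: "0 \<le> W B" unfolding W_def set_lebesgue_integral_def
    using w_nonneg by (intro Bochner_Integration.integral_nonneg) auto
  moreover have "W B \<noteq> 0"
  proof
    assume "W B = 0"
    then have "AE x in sellers E. indicator B x *\<^sub>R w x = 0"
      using integral_nonneg_eq_0_iff_AE[of "sellers E" "\<lambda>x. indicator B x *\<^sub>R w x"]
        w_integrable[OF B] w_nonneg by (auto simp: W_def set_lebesgue_integral_def set_integrable_def)
    then have "AE x in sellers E. x \<notin> B"
      using w_pos sub by (auto elim!: eventually_mono simp: indicator_def split: if_splits) force
    then have "measure (sellers E) B = 0"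
      using sellers.prob_eq_0[OF B] by simp
    then show False using assms(2) by simp
  qed
  ultimately show ?thesis by simp
qed

text \<open>The admissible members of an information structure, isolated so that a set can be
  studied on its own. The family is nonempty, which keeps \<open>W B\<close> positive.\<close>

definition cell :: "real set \<Rightarrow> bool" where
  "cell B \<longleftrightarrow> (\<exists>\<A>. \<A> \<noteq> {} \<and> \<A> \<subseteq> set (parts E) \<and> B = \<Union>\<A>)"

lemma part_sets: "A \<in> set (parts E) \<Longrightarrow> A \<in> sets (sellers E)"
  and part_W_pos: "A \<in> set (parts E) \<Longrightarrow> 0 < W A"
  using market W_pos by (auto simp: quality_market_def)

lemma part_cell: "A \<in> set (parts E) \<Longrightarrow> cell A"
  unfolding cell_def by (rule exI[of _ "{A}"]) auto

lemma cell_sets: "cell B \<Longrightarrow> B \<in> sets (sellers E)"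
  unfolding cell_def using part_sets
  by (metis List.finite_set finite_subset sets.finite_Union subset_iff)

lemma q_W: "W B \<noteq> 0 \<Longrightarrow> q B * W B = (LINT x:B|sellers E. x * w x)"
  by (simp add: quality_def W_def w_def)

lemma W_Union:
  assumes "\<A> \<subseteq> set (parts E)"
  shows "W (\<Union>\<A>) = (\<Sum>A\<in>\<A>. W A)"
    and "(LINT x:\<Union>\<A>|sellers E. x * w x) = (\<Sum>A\<in>\<A>. (LINT x:A|sellers E. x * w x))"
proof -
  have fin: "finite \<A>" using assms finite_subset by blast
  have "partition_on {0..xbar E} (set (parts E))" using market by (simp add: quality_market_def)
  then have "disjoint \<A>" using assms by (auto simp: partition_on_def intro: pairwise_subset)
  then have dj: "disjoint_family_on (\<lambda>A. A) \<A>"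
    by (auto simp: disjoint_family_on_def disjoint_def)
  have s: "\<And>A. A \<in> \<A> \<Longrightarrow> A \<in> sets (sellers E)" using assms part_sets by auto
  show "W (\<Union>\<A>) = (\<Sum>A\<in>\<A>. W A)"
    using set_integral_finite_Union[OF fin dj, of "sellers E" w] s w_integrable by (simp add: W_def)
  show "(LINT x:\<Union>\<A>|sellers E. x * w x) = (\<Sum>A\<in>\<A>. (LINT x:A|sellers E. x * w x))"
    using set_integral_finite_Union[OF fin dj, of "sellers E" "\<lambda>x. x * w x"] s xw_integrable by simp
qed

lemma cell_W_pos:
  assumes "cell B"
  shows "0 < W B"
proof -
  obtain \<A> where A: "\<A> \<noteq> {}" "\<A> \<subseteq> set (parts E)" "B = \<Union>\<A>"
    using assms by (auto simp: cell_def)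
  then have "finite \<A>" using finite_subset by blast
  then show ?thesis using A part_W_pos by (auto simp: W_Union intro!: sum_pos)
qed

text \<open>The quality of a union is a weighted mean of the qualities of the elements it joins.\<close>

lemma best_part:
  assumes "cell B"
  obtains A where "A \<in> set (parts E)" "q B \<le> q A" "A = B \<or> W A < W B"
proof -
  obtain \<A> where A: "\<A> \<noteq> {}" "\<A> \<subseteq> set (parts E)" "B = \<Union>\<A>"
    using assms by (auto simp: cell_def)
  then have fin: "finite \<A>" using finite_subset by blast
  have pos: "A \<in> \<A> \<Longrightarrow> 0 < W A" for A using A part_W_pos by auto
  have "q B * W B = (\<Sum>A\<in>\<A>. q A * W A)"
  proof -
    have "(\<Sum>A\<in>\<A>. q A * W A) = (\<Sum>A\<in>\<A>. (LINT x:A|sellers E. x * w x))"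
      using pos by (intro sum.cong q_W) (auto simp: less_imp_neq[symmetric])
    then show ?thesis
      using q_W[of B] cell_W_pos[OF assms] A by (simp add: W_Union)
  qed
  then have eq: "(\<Sum>A\<in>\<A>. q A * W A) = (\<Sum>A\<in>\<A>. q B * W A)"
    using A by (simp add: W_Union sum_distrib_left)
  \<comment> \<open>If every element fell short of \<open>q B\<close>, the two sums in
    \<open>eq\<close> would differ, since the weights \<open>W A\<close> are positive.\<close>
  obtain A where AA: "A \<in> \<A>" "q B \<le> q A"
  proof (rule ccontr)
    assume "\<not> thesis"
    then have "A \<in> \<A> \<Longrightarrow> q A < q B" for A using that by force
    then have "(\<Sum>A\<in>\<A>. q A * W A) < (\<Sum>A\<in>\<A>. q B * W A)"
      using fin A pos by (intro sum_strict_mono) auto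
    then show False using eq by simp
  qed
  have "A = B \<or> W A < W B"
  proof (cases "\<A> = {A}")
    case False
    then obtain A' where "A' \<in> \<A> - {A}" using AA by blast
    then have "0 < (\<Sum>A\<in>\<A> - {A}. W A)"
      using fin pos by (intro sum_pos) auto
    then show ?thesis using A AA fin by (simp add: W_Union sum.remove[of \<A> A])
  qed (use A in auto)
  then show thesis using that AA A by auto
qed

subsection \<open>Demand and equilibrium\<close>

text \<open>\<open>buyer_utility\<close> with the belief mean replaced by its price-free value; the
  two agree at positive prices.\<close>

definition util :: "real set list \<Rightarrow> real list \<Rightarrow> nat \<Rightarrow> real \<Rightarrow> real" where
  "util I p i m = m * q (I ! i) - p ! i"

text \<open>The last clause is the tie-breaking rule: an indifferent buyer moves to the higher
  index, so the sets for different indices are disjoint.\<close>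

definition customers :: "real set list \<Rightarrow> real list \<Rightarrow> nat \<Rightarrow> real set" where
  "customers I p i = {m \<in> {lo E..hi E}. 0 \<le> util I p i m \<and>
     (\<forall>j<length I. util I p j m \<le> util I p i m) \<and>
     (\<forall>j. i < j \<and> j < length I \<longrightarrow> util I p j m \<noteq> util I p i m)}"

lemma customers_measurable [measurable]: "customers I p i \<in> sets borel"
proof -
  have "customers I p i = {m \<in> space borel. m \<in> {lo E..hi E} \<and> 0 \<le> util I p i m \<and>
     (\<forall>j\<in>{..<length I}. util I p j m \<le> util I p i m) \<and>
     (\<forall>j\<in>{i<..<length I}. util I p j m \<noteq> util I p i m)}"
    by (auto simp: customers_def)
  also have "\<dots> \<in> sets borel"
    unfolding util_def by measurable
  finally show ?thesis .
qed

lemma info_cell: "info_structure E I \<Longrightarrow> i < length I \<Longrightarrow> cell (I ! i)"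
  by (auto simp: info_structure_def cell_def)

lemma info_singleton: "info_structure E [B] \<longleftrightarrow> cell B"
  by (auto simp: info_structure_def cell_def)

lemma demand_eq:
  assumes "info_structure E I" "\<And>i. i < length I \<Longrightarrow> 0 < p ! i" "i < length I"
  shows "demand_of E I p i = measure (buyers E) (customers I p i)"
proof -
  have u: "buyer_utility E m (I ! j) (p ! j) = util I p j m" if "j < length I" for j m
    using assms that
    by (simp add: buyer_utility_def util_def mean_quality_eq[OF market cell_sets[OF info_cell]])
  have "(MAX j\<in>{..<length I}. buyer_utility E m (I ! j) (p ! j)) = (MAX j\<in>{..<length I}. util I p j m)" for m
    by (intro arg_cong[where f = Max] image_cong) (auto simp: u)
  moreover have "util I p i m = (MAX j\<in>{..<length I}. util I p j m) \<longleftrightarrow>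
      (\<forall>j<length I. util I p j m \<le> util I p i m)" for m
    using assms(3) by (subst eq_commute, subst Max_eq_iff) auto
  ultimately have "demand_of E I p i = (LINT m|buyers E. indicator (customers I p i) m)"
    unfolding demand_of_def set_lebesgue_integral_def
    by (intro Bochner_Integration.integral_cong)
      (auto simp: u assms(3) customers_def indicator_def)
  then show ?thesis by simp
qed

lemma measure_restrict_types:
  assumes "A \<in> sets borel"
  shows "measure (buyers E) (A \<inter> {lo E..hi E}) = measure (buyers E) A"
proof -
  have "measure (buyers E) A = measure (buyers E) (A \<inter> {lo E..hi E}) + measure (buyers E) (A - {lo E..hi E})"
    using assms by (subst buyers.finite_measure_Union[symmetric])
      (auto intro!: arg_cong[where f = "measure (buyers E)"])
  moreover have "measure (buyers E) (A - {lo E..hi E}) = 0"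
  proof (rule buyers_null)
    have "(A - {lo E..hi E}) \<inter> {lo E..hi E} = {}" by blast
    then show "emeasure lborel ((A - {lo E..hi E}) \<inter> {lo E..hi E}) = 0" by (metis emeasure_empty)
  qed (use assms in auto)
  ultimately show ?thesis by simp
qed

lemma demand_single:
  assumes "cell B" "0 < p" "0 < q B"
  shows "demand_of E [B] [p] 0 = 1 - F (p / q B)"
proof -
  have "customers [B] [p] 0 = {p / q B..} \<inter> {lo E..hi E}"
    using assms by (auto simp: customers_def util_def field_simps)
  moreover have "demand_of E [B] [p] 0 = measure (buyers E) (customers [B] [p] 0)"
    using assms by (intro demand_eq) (auto simp: info_singleton)
  ultimately show ?thesis
    using measure_restrict_types[of "{p / q B..}"] measure_atLeast by simp
qed

text \<open>No set is idle in equilibrium: supply at a positive price is positive, and market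
  clearing passes this on to the buyers.\<close>

lemma implementable_customers:
  assumes "implementable E I p" "i < length I"
  shows "supply_of E (I ! i) (p ! i) = measure (buyers E) (customers I p i)"
    and "0 < measure (buyers E) (customers I p i)"
proof -
  have *: "info_structure E I" "\<And>i. i < length I \<Longrightarrow> 0 < p ! i"
    "supply_of E (I ! i) (p ! i) = demand_of E I p i"
    using assms by (auto simp: implementable_def)
  show eq: "supply_of E (I ! i) (p ! i) = measure (buyers E) (customers I p i)"
    using * assms(2) by (simp add: demand_eq)
  have "cell (I ! i)" using * assms(2) info_cell by blast
  then have "0 < supply_of E (I ! i) (p ! i)"
    using *(2)[OF assms(2)] cell_W_pos by (simp add: supply_eq cell_sets)
  then show "0 < measure (buyers E) (customers I p i)" by (simp add: eq)
qed

lemma implementable_served: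
  assumes "implementable E I p" "i < length I"
  obtains m where "m \<in> customers I p i"
  using implementable_customers(2)[OF assms] by fastforce

text \<open>Some customer of nonnegative type pays a positive price, which zero or negative quality
  would not justify.\<close>

lemma implementable_q_pos:
  assumes "implementable E I p" "i < length I"
  shows "0 < q (I ! i)"
proof -
  obtain m where "m \<in> customers I p i" using implementable_served[OF assms] .
  then have "0 \<le> m" "p ! i \<le> m * q (I ! i)" using lo_nonneg by (auto simp: customers_def util_def)
  moreover have "0 < p ! i" using assms by (simp add: implementable_def)
  ultimately show ?thesis using mult_nonneg_nonpos[of m "q (I ! i)"] by linarith
qed

lemma implementable_menu:
  assumes "implementable E I p"
  shows "induced_menu E I p = (\<lambda>i. (p ! i, q (I ! i))) ` {..<length I}"
  unfolding induced_menu_def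
proof (rule image_cong[OF refl])
  fix i assume "i \<in> {..<length I}"
  then have "cell (I ! i)" "0 < p ! i"
    using assms info_cell by (auto simp: implementable_def)
  then show "(p ! i, mean_quality E (I ! i) (p ! i)) = (p ! i, q (I ! i))"
    by (simp add: mean_quality_eq[OF market cell_sets])
qed

text \<open>At equal prices the customers of the higher index reveal that its quality is at least as
  good. Then every customer of the lower index weakly prefers the higher one and is sent there by
  the tie-breaking rule, so the lower index has no customers.\<close>

lemma implementable_price_inj:
  assumes "implementable E I p" "i < length I" "j < length I" "p ! i = p ! j"
  shows "i = j"
proof -
  have "\<not> a < b" if ab: "a < length I" "b < length I" "p ! a = p ! b" for a b
  proof
    assume "a < b"
    obtain m where m: "m \<in> customers I p a" using implementable_served[OF assms(1) ab(1)] .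
    obtain m' where m': "m' \<in> customers I p b" using implementable_served[OF assms(1) ab(2)] .
    have "0 \<le> m'" "p ! b \<le> m' * q (I ! b)" using m' lo_nonneg by (auto simp: customers_def util_def)
    moreover have "0 < p ! b" using assms ab by (simp add: implementable_def)
    ultimately have "0 < m'" by (cases "m' = 0") auto
    moreover have "0 \<le> m" using m lo_nonneg by (auto simp: customers_def)
    moreover have "m' * q (I ! a) \<le> m' * q (I ! b)" 
      using m' ab by (auto simp: customers_def util_def)
    ultimately have "q (I ! a) \<le> q (I ! b)" "m * q (I ! a) \<le> m * q (I ! b)"
      by (auto intro: mult_left_mono)
    moreover have "m * q (I ! b) - p ! b \<noteq> m * q (I ! a) - p ! a"
      "m * q (I ! b) - p ! b \<le> m * q (I ! a) - p ! a"
      using m ab \<open>a < b\<close> by (auto simp: customers_def util_def)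
    ultimately show False using ab by simp
  qed
  then show ?thesis using assms by (metis linorder_neqE_nat)
qed

text \<open>Rival sets only take customers away: standing alone at its menu price, the set would
  face at least its present demand, so supply does not exceed demand.\<close>

lemma implementable_supply_le:
  assumes "implementable E I p" "i < length I"
  shows "(p ! i) powr (1 / elasticity E) * W (I ! i) \<le> 1 - F (p ! i / q (I ! i))"
proof -
  have i: "cell (I ! i)" "0 < p ! i"
    using assms info_cell by (auto simp: implementable_def)
  have "measure (buyers E) (customers I p i) \<le> measure (buyers E) {p ! i / q (I ! i)..}"
    using implementable_q_pos[OF assms]
    by (intro buyers.finite_measure_mono) (auto simp: customers_def util_def field_simps)
  then show ?thesis
    using implementable_customers(1)[OF assms] i by (simp add: measure_atLeast supply_eq cell_sets)
qed

section \<open>Equilibria of a single set\<close>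

lemma WQ_single_iff:
  "([B], [p]) \<in> WQ E \<longleftrightarrow>
     cell B \<and> 0 < p \<and> 0 < q B \<and> p powr (1 / elasticity E) * W B = 1 - F (p / q B)" (is "?l \<longleftrightarrow> ?r")
proof
  assume ?l
  then have i: "implementable E [B] [p]" by (simp add: WQ_def)
  then have "cell B" "0 < p" by (auto simp: implementable_def info_singleton)
  moreover have "0 < q B" using implementable_q_pos[OF i, of 0] by simp
  moreover have "supply_of E B p = demand_of E [B] [p] 0" using i by (simp add: implementable_def)
  ultimately show ?r by (simp add: supply_eq cell_sets demand_single)
next
  assume ?r
  then show ?l by (simp add: WQ_def implementable_def info_singleton supply_eq cell_sets demand_single)
qed

text \<open>Intermediate value theorem: demand covers supply at \<open>x\<close> and vanishes at a
  high price. Market clearing is the equation \<open>g p = 1\<close>.\<close>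

lemma equilibrium_above:
  assumes "cell B" "0 < q B" "0 < x"
    and "x powr (1 / elasticity E) * W B \<le> 1 - F (x / q B)"
  obtains p where "x \<le> p" "([B], [p]) \<in> WQ E"
proof -
  define g where "g p = p powr (1 / elasticity E) * W B + F (p / q B)" for p
  \<comment> \<open>At the price \<open>hi E * q B\<close> even the highest type gains nothing from
    buying.\<close>
  define y where "y = max x (hi E * q B)"
  have "continuous_on {x..y} (\<lambda>p. F (p / q B))"
    using assms by (intro continuous_on_divide F_cont) (auto intro: continuous_intros)
  then have "continuous_on {x..y} g"
    unfolding g_def using assms by (intro continuous_intros) auto
  moreover have "g x \<le> 1" using assms(4) by (simp add: g_def)
  moreover have "1 \<le> g y"
  proof -
    have "F (y / q B) = 1" using assms by (intro F_hi) (auto simp: y_def field_simps)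
    then show ?thesis using cell_W_pos[OF assms(1)] by (simp add: g_def)
  qed
  moreover have "x \<le> y" by (simp add: y_def)
  ultimately obtain p where "x \<le> p" "g p = 1" using IVT'[of g x 1 y] by auto
  then show thesis using assms by (intro that[of p]) (auto simp: WQ_single_iff g_def)
qed

text \<open>Supply strictly increases and demand weakly decreases in the price, so no equilibrium
  lies above a price at which supply covers demand.\<close>

lemma equilibrium_below:
  assumes "([B], [p]) \<in> WQ E" "0 < x"
    and "1 - F (x / q B) \<le> x powr (1 / elasticity E) * W B"
  shows "p \<le> x"
proof (rule ccontr)
  assume "\<not> p \<le> x"
  have p: "cell B" "0 < q B" "p powr (1 / elasticity E) * W B = 1 - F (p / q B)"
    using assms(1) by (auto simp: WQ_single_iff)
  have "x powr (1 / elasticity E) * W B < p powr (1 / elasticity E) * W B"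
    using \<open>\<not> p \<le> x\<close> assms(2) elasticity_pos cell_W_pos[OF p(1)]
    by (intro mult_strict_right_mono powr_less_mono2) auto
  moreover have "F (x / q B) \<le> F (p / q B)"
    using \<open>\<not> p \<le> x\<close> p by (intro F_mono divide_right_mono) auto
  ultimately show False using assms(3) p by simp
qed

text \<open>At the old price the element from \<open>best_part\<close> has no less demand and, if it
  differs from \<open>B\<close>, strictly less supply; the resulting excess demand raises the price
  strictly.\<close>

lemma best_part_equilibrium:
  assumes "([B], [p]) \<in> WQ E"
  obtains A p' where "A \<in> set (parts E)" "([A], [p']) \<in> WQ E" "p \<le> p'" "q B \<le> q A" "A = B \<or> p < p'"
proof -
  have B: "cell B" "0 < p" "0 < q B" "p powr (1 / elasticity E) * W B = 1 - F (p / q B)"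
    using assms by (auto simp: WQ_single_iff)
  obtain A where A: "A \<in> set (parts E)" "q B \<le> q A" "A = B \<or> W A < W B"
    using best_part[OF B(1)] .
  show thesis
  proof (cases "A = B")
    case True
    then show ?thesis using that[of A p] A assms by auto
  next
    case False
    have "p powr (1 / elasticity E) * W A < p powr (1 / elasticity E) * W B"
      using A False B by (intro mult_strict_left_mono) auto
    moreover have "F (p / q A) \<le> F (p / q B)"
      using A B by (intro F_mono divide_left_mono) auto
    ultimately have lt: "p powr (1 / elasticity E) * W A < 1 - F (p / q A)" using B by simp
    obtain p' where p': "p \<le> p'" "([A], [p']) \<in> WQ E"
      using equilibrium_above[of A p] lt A B part_cell by force
    moreover have "p \<noteq> p'" using lt p'(2) by (auto simp: WQ_single_iff)
    ultimately show ?thesis using that[of A p'] A by auto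
  qed
qed

end

locale convex_goods_market = goods_market +
  assumes convex: "strictly_convex_on {lo E..hi E} (\<lambda>m. type_cdf E m * m)"
begin

subsection \<open>Concavity of the unit revenue\<close>

lemma R_lo: "x \<le> lo E \<Longrightarrow> R x = x" and R_hi: "hi E \<le> x \<Longrightarrow> R x = 0"
  by (simp_all add: R_def F_lo F_hi)

text \<open>
  Below \<^term>\<open>lo E\<close> the function \<open>F m * m\<close> vanishes and beyond it is nonnegative, so that
  convexity extends from \<open>[lo E, hi E]\<close> to \<open>[0, hi E]\<close>.
\<close>

lemma R_concave_less:
  assumes "0 \<le> x" "x < y" "y \<le> hi E" "0 < t" "t < 1"
  shows "(1 - t) * R x + t * R y \<le> R ((1 - t) * x + t * y)"
proof -
  define h where "h m = F m * m" for m
  define z where "z = (1 - t) * x + t * y"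
  have h_nonneg: "0 \<le> h m" if "0 \<le> m" for m using that F_nonneg by (simp add: h_def)
  have zx: "z - x = t * (y - x)" and yz: "y - z = (1 - t) * (y - x)"
    by (simp_all add: z_def algebra_simps)
  have "0 < z - x" "0 < y - z"
    unfolding zx yz using assms by simp_all
  then have z: "x < z" "z < y" by simp_all
  have conv: "h ((1 - s) * u + s * v) \<le> (1 - s) * h u + s * h v"
    if "lo E \<le> u" "u < v" "v \<le> hi E" "0 < s" "s < 1" for s u v
    using convex that unfolding strictly_convex_on_def h_def by (auto intro!: less_imp_le)
  have "h z \<le> (1 - t) * h x + t * h y"
  proof -
    consider "lo E \<le> x" | "z \<le> lo E" | "x < lo E" "lo E < z" by linarith
    then show ?thesis
    proof cases
      case 1
      then show ?thesis using conv[of x y t] assms by (simp add: z_def)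
    next
      case 2
      then have "h z = 0" by (simp add: h_def F_lo)
      moreover have "0 \<le> (1 - t) * h x + t * h y" using assms h_nonneg by auto
      ultimately show ?thesis by simp
    next
      case 3
      \<comment> \<open>\<open>s\<close> writes \<open>z\<close> as a mean of \<open>lo E\<close>
        and \<open>y\<close>. Since \<open>h\<close> vanishes at both \<open>x\<close> and
        \<open>lo E\<close>, only the weights of \<open>h y\<close> have to be compared, and
        \<open>s \<le> t\<close>.\<close>
      define s where "s = (z - lo E) / (y - lo E)"
      have s: "0 < s" "s < 1" using 3 z by (simp_all add: s_def)
      have sy: "s * (y - lo E) = z - lo E" using 3 z by (simp add: s_def)
      have "(t - s) * (y - lo E) = (1 - t) * (lo E - x)"
        using zx sy by (simp add: algebra_simps)
      also have "\<dots> \<ge> 0" using 3 assms by simp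
      finally have "s \<le> t" using 3 z by (simp add: zero_le_mult_iff)
      have "z = (1 - s) * lo E + s * y" using sy by (simp add: algebra_simps)
      then have "h z \<le> (1 - s) * h (lo E) + s * h y"
        using conv[of "lo E" y s] s 3 z assms by simp
      also have "\<dots> = s * h y" by (simp add: h_def F_lo)
      also have "\<dots> \<le> t * h y" using \<open>s \<le> t\<close> assms h_nonneg[of y] by (intro mult_right_mono) auto
      also have "\<dots> = (1 - t) * h x + t * h y" using 3 by (simp add: h_def F_lo)
      finally show ?thesis .
    qed
  qed
  moreover have R_h: "R m = m - h m" for m by (simp add: R_def h_def algebra_simps)
  have "(1 - t) * R x + t * R y = z - ((1 - t) * h x + t * h y)" "R z = z - h z"
    unfolding R_h by (simp_all add: z_def algebra_simps)
  ultimately show ?thesis by (simp add: z_def)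
qed

lemma R_concave:
  assumes "x \<in> {0..hi E}" "y \<in> {0..hi E}" "0 < t" "t < 1"
  shows "(1 - t) * R x + t * R y \<le> R ((1 - t) * x + t * y)"
proof -
  consider "x < y" | "x = y" | "y < x" by linarith
  then show ?thesis
  proof cases
    case 2
    then show ?thesis by (simp add: algebra_simps)
  next
    case 3
    then show ?thesis using R_concave_less[of y x "1 - t"] assms by (simp add: add.commute)
  qed (use R_concave_less assms in auto)
qed

text \<open>Superadditivity of the perspective of a concave function: \<open>R_concave\<close> with
  weights proportional to \<open>Q\<^sub>1\<close> and \<open>Q\<^sub>2\<close>.\<close>

lemma R_perspective:
  assumes "0 < Q\<^sub>1" "0 < Q\<^sub>2" "P\<^sub>1 / Q\<^sub>1 \<in> {0..hi E}" "P\<^sub>2 / Q\<^sub>2 \<in> {0..hi E}"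
  shows "Q\<^sub>1 * R (P\<^sub>1 / Q\<^sub>1) + Q\<^sub>2 * R (P\<^sub>2 / Q\<^sub>2) \<le> (Q\<^sub>1 + Q\<^sub>2) * R ((P\<^sub>1 + P\<^sub>2) / (Q\<^sub>1 + Q\<^sub>2))"
proof -
  define S t where "S = Q\<^sub>1 + Q\<^sub>2" and "t = Q\<^sub>2 / S"
  have S: "0 < S" using assms by (simp add: S_def)
  have t: "0 < t" "t < 1" "S * t = Q\<^sub>2" "S * (1 - t) = Q\<^sub>1"
    using assms S by (simp_all add: t_def S_def field_simps)
  have "(P\<^sub>1 + P\<^sub>2) / S = (1 - t) * (P\<^sub>1 / Q\<^sub>1) + t * (P\<^sub>2 / Q\<^sub>2)"
  proof -
    have "S * ((1 - t) * (P\<^sub>1 / Q\<^sub>1) + t * (P\<^sub>2 / Q\<^sub>2)) = (S * (1 - t)) * (P\<^sub>1 / Q\<^sub>1) + (S * t) * (P\<^sub>2 / Q\<^sub>2)"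
      by (simp only: distrib_left mult.assoc)
    also have "\<dots> = P\<^sub>1 + P\<^sub>2" using assms t by simp
    finally show ?thesis using S by (metis nonzero_mult_div_cancel_left less_irrefl)
  qed
  then have "S * ((1 - t) * R (P\<^sub>1 / Q\<^sub>1) + t * R (P\<^sub>2 / Q\<^sub>2)) \<le> S * R ((P\<^sub>1 + P\<^sub>2) / S)"
    using R_concave[OF assms(3,4) t(1,2)] S by simp
  moreover have "S * ((1 - t) * R (P\<^sub>1 / Q\<^sub>1) + t * R (P\<^sub>2 / Q\<^sub>2)) =
      (S * (1 - t)) * R (P\<^sub>1 / Q\<^sub>1) + (S * t) * R (P\<^sub>2 / Q\<^sub>2)"
    by (simp add: algebra_simps)
  ultimately show ?thesis using t by (simp add: S_def)
qed

section \<open>The maximizer of the unit revenue and monopoly prices\<close>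

lemma R_pos: "\<exists>m\<in>{0..hi E}. 0 < R m"
proof -
  \<comment> \<open>At the midpoint \<open>m\<close> the chord value is \<open>hi E / 2\<close>, so
    \<open>R m > m - hi E / 2 = lo E / 2\<close>, which is nonnegative.\<close>
  have "F ((1 - 1/2) * lo E + 1/2 * hi E) * ((1 - 1/2) * lo E + 1/2 * hi E)
      < (1 - 1/2) * (F (lo E) * lo E) + 1/2 * (F (hi E) * hi E)"
    using convex[unfolded strictly_convex_on_def, rule_format, of "lo E" "hi E" "1/2"] lo_less_hi
    by simp
  then have "0 < R ((lo E + hi E) / 2)"
    using lo_nonneg by (simp add: R_def F_lo F_hi algebra_simps add_divide_distrib)
  then show ?thesis using lo_nonneg lo_less_hi by (intro bexI[of _ "(lo E + hi E) / 2"]) auto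
qed

definition peak :: real where
  "peak = (SOME m. m \<in> {0..hi E} \<and> (\<forall>x\<in>{0..hi E}. R x \<le> R m))"

lemma peak_max: "peak \<in> {0..hi E}" "x \<in> {0..hi E} \<Longrightarrow> R x \<le> R peak"
proof -
  have "continuous_on {0..hi E} R"
    unfolding R_def by (intro continuous_intros F_cont)
  then have "\<exists>m. m \<in> {0..hi E} \<and> (\<forall>x\<in>{0..hi E}. R x \<le> R m)"
    using continuous_attains_sup[of "{0..hi E}" R] hi_pos by auto
  from someI_ex[OF this] have "peak \<in> {0..hi E} \<and> (\<forall>x\<in>{0..hi E}. R x \<le> R peak)"
    unfolding peak_def .
  then show "peak \<in> {0..hi E}" "x \<in> {0..hi E} \<Longrightarrow> R x \<le> R peak" by auto
qed

lemma R_peak_pos: "0 < R peak"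
  using R_pos peak_max(2) by (meson less_le_trans)

lemma peak_pos: "0 < peak"
  using R_peak_pos peak_max(1) by (cases "peak = 0") (auto simp: R_def)

text \<open>Strict convexity is available only on \<open>[lo E, hi E]\<close>, so maximizers are
  first placed there: below \<open>lo E\<close> the function \<open>R\<close> is the identity, above
  \<open>hi E\<close> it is 0. The midpoint of two maximizers would then earn strictly more.\<close>

lemma R_less_peak:
  assumes "0 \<le> x" "x \<noteq> peak"
  shows "R x < R peak"
proof (cases "x \<le> hi E")
  case False
  then show ?thesis using R_hi[of x] R_peak_pos by simp
next
  case True
  have lo: "lo E \<le> m" if "m \<in> {0..hi E}" "R m = R peak" for m
  proof (rule ccontr)
    assume "\<not> lo E \<le> m"
    then have "R m < R (lo E)" by (simp add: R_lo)
    also have "\<dots> \<le> R peak" using lo_nonneg lo_less_hi by (intro peak_max) auto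
    finally show False using that by simp
  qed
  have "R x \<noteq> R peak"
  proof
    assume eq: "R x = R peak"
    define z where "z = (1 - 1/2) * x + 1/2 * peak"
    have "F z * z < (1 - 1/2) * (F x * x) + 1/2 * (F peak * peak)"
      unfolding z_def
      using convex[unfolded strictly_convex_on_def, rule_format, of x peak "1/2"]
        assms lo[of x] lo[of peak] eq True peak_max(1) by simp
    then have "(R x + R peak) / 2 < z - F z * z"
      by (simp add: z_def R_def field_simps)
    also have "z - F z * z = R z" by (simp add: R_def algebra_simps)
    finally have "(R x + R peak) / 2 < R z" .
    moreover have "R z \<le> R peak" using assms True peak_max(1) by (intro peak_max) (auto simp: z_def)
    ultimately show False using eq by simp
  qed
  then show ?thesis using peak_max(2)[of x] assms True by simp
qed

text \<open>A concave function increases up to its maximizer: \<open>y\<close> is a mean of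
  \<open>x\<close> and \<open>peak\<close>, with weight \<open>t\<close> on
  \<open>peak\<close>.\<close>

lemma R_mono:
  assumes "0 \<le> x" "x \<le> y" "y \<le> peak"
  shows "R x \<le> R y"
proof (cases "x = y \<or> y = peak")
  case True
  then show ?thesis using peak_max assms by auto
next
  case False
  define t where "t = (y - x) / (peak - x)"
  have t: "0 < t" "t < 1" using assms False by (simp_all add: t_def)
  have "t * (peak - x) = y - x" using assms False by (simp add: t_def)
  then have "y = (1 - t) * x + t * peak" by (simp add: algebra_simps)
  then have "(1 - t) * R x + t * R peak \<le> R y"
    using R_concave[of x peak t] t assms peak_max(1) by simp
  moreover have "t * R x \<le> t * R peak"
    using t assms peak_max by (intro mult_left_mono) auto
  ultimately show ?thesis by (simp add: algebra_simps)
qed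

text \<open>Substituting \<open>p = Q * m\<close> turns the objective into
  \<open>Q * R m\<close>.\<close>

lemma arg_max_price_iff:
  assumes "0 < Q"
  shows "is_arg_max (\<lambda>p. p * (1 - F (p / Q))) (\<lambda>p. 0 \<le> p) p \<longleftrightarrow> p = peak * Q"
proof -
  have eq: "p * (1 - F (p / Q)) = Q * R (p / Q)" for p
    using assms by (simp add: R_def)
  have max: "Q * R (p / Q) < Q * R peak" if "0 \<le> p" "p \<noteq> peak * Q" for p
    using assms that by (intro mult_strict_left_mono R_less_peak) (simp_all add: divide_eq_eq)
  have Q: "peak * Q / Q = peak" "0 \<le> peak * Q" using assms peak_pos by auto
  show ?thesis
    unfolding is_arg_max_def eq
  proof (intro iffI conjI notI)
    assume "0 \<le> p \<and> (\<nexists>y. 0 \<le> y \<and> Q * R (p / Q) < Q * R (y / Q))"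
    then have "0 \<le> p" "\<not> Q * R (p / Q) < Q * R (peak * Q / Q)" using Q(2) by blast+
    then show "p = peak * Q" unfolding Q(1) using max[of p] by blast
  next
    assume p: "p = peak * Q"
    then show "0 \<le> p" using Q by simp
    assume "\<exists>y. 0 \<le> y \<and> Q * R (p / Q) < Q * R (y / Q)"
    then obtain y where "0 \<le> y" "Q * R peak < Q * R (y / Q)" using p Q by auto
    then show False using max[of y] Q by (cases "y = peak * Q") auto
  qed
qed

lemma pM_eq: "0 < Q \<Longrightarrow> pM E Q = peak * Q"
  by (simp add: pM_def arg_max_price_iff)

lemma monopoly_price_eq: "0 < q B \<Longrightarrow> monopoly_price E B = peak * q B"
  by (simp add: monopoly_price_def arg_max_def arg_max_price_iff)

text \<open>Two moves: better quality at the old price adds demand, and then the price rises along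
  the increasing branch of \<open>R\<close>.\<close>

lemma single_revenue_mono:
  assumes "0 < Q" "Q \<le> Q'" "0 < p" "p \<le> p'" "p' \<le> peak * Q'"
  shows "p * (1 - F (p / Q)) \<le> p' * (1 - F (p' / Q'))"
proof -
  have "p * (1 - F (p / Q)) \<le> p * (1 - F (p / Q'))"
    using assms by (intro mult_left_mono diff_left_mono F_mono divide_left_mono) auto
  also have "\<dots> = Q' * R (p / Q')" using assms by (simp add: R_def)
  also have "\<dots> \<le> Q' * R (p' / Q')"
    using assms by (intro mult_left_mono R_mono divide_right_mono) (auto simp: field_simps)
  also have "\<dots> = p' * (1 - F (p' / Q'))" using assms by (simp add: R_def)
  finally show ?thesis .
qed

subsection \<open>Menus with several pairs\<close>

text \<open>
  Summation by parts turns the revenue into a sum over \<open>i\<close> of the price increment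
  \<open>P i - P (i - 1)\<close> times the mass of buyers who choose some \<open>j \<ge> i\<close>.  By single crossing this mass
  is at most \<open>1 - F m\<close> at the cutoff type \<open>m = (P i - P (i - 1)) / (Q i - Q (i - 1))\<close>, so each summand is at most
  \<open>(Q i - Q (i - 1)) * R m\<close>, and concavity of \<open>R\<close> merges the summands.
\<close>

lemma sorted_menu_revenue:
  fixes P Q :: "nat \<Rightarrow> real" and C :: "nat \<Rightarrow> real set"
  assumes meas: "\<And>i. i < n \<Longrightarrow> C i \<in> sets borel" and disj: "disjoint_family_on C {..<n}"
    and nonempty: "\<And>i. i < n \<Longrightarrow> C i \<noteq> {}"
    and types: "\<And>i m. i < n \<Longrightarrow> m \<in> C i \<Longrightarrow> m \<in> {0..hi E}"
    and ir: "\<And>i m. i < n \<Longrightarrow> m \<in> C i \<Longrightarrow> P i \<le> m * Q i"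
    and ic: "\<And>i j m. i < n \<Longrightarrow> j < n \<Longrightarrow> m \<in> C i \<Longrightarrow> m * Q j - P j \<le> m * Q i - P i"
    and pos: "\<And>i. i < n \<Longrightarrow> 0 < P i" and mono: "\<And>i j. i < j \<Longrightarrow> j < n \<Longrightarrow> P i < P j"
    and "k < n"
  shows "(\<Sum>i\<le>k. P i * measure (buyers E) (C i)) + P k * measure (buyers E) (\<Union>i\<in>{Suc k..<n}. C i)
    \<le> Q k * R (P k / Q k)"
proof -
  let ?\<mu> = "measure (buyers E)"
  define T where "T k = ?\<mu> (\<Union>i\<in>{k..<n}. C i)" for k
  have T_rec: "T k = ?\<mu> (C k) + T (Suc k)" if "k < n" for k
  proof -
    have "{k..<n} = insert k {Suc k..<n}" using that by auto
    then have "T k = ?\<mu> (C k \<union> (\<Union>i\<in>{Suc k..<n}. C i))" by (simp add: T_def)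
    also have "\<dots> = ?\<mu> (C k) + T (Suc k)"
      unfolding T_def
    proof (rule buyers.finite_measure_Union)
      have "C k \<inter> C i = {}" if "i \<in> {Suc k..<n}" for i
        using disjoint_family_onD[OF disj, of k i] that \<open>k < n\<close> by simp
      then show "C k \<inter> (\<Union>i\<in>{Suc k..<n}. C i) = {}" by blast
    qed (use meas that in auto)
    finally show ?thesis .
  qed
  have Q_mono: "Q i < Q j" if ij: "i < j" "j < n" for i j
  proof -
    obtain m where m: "m \<in> C j" using nonempty[OF ij(2)] by blast
    then have "0 < m * (Q j - Q i)"
      using ic[of j i m] mono[OF ij] ij by (simp add: algebra_simps)
    then show ?thesis using types[OF ij(2) m] by (simp add: zero_less_mult_iff)
  qed
  have Q_pos: "0 < Q i" if i: "i < n" for i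
  proof -
    obtain m where m: "m \<in> C i" using nonempty[OF i] by blast
    then have "0 < m * Q i" using ir[OF i m] pos[OF i] by linarith
    then show ?thesis using types[OF i m] by (simp add: zero_less_mult_iff)
  qed
  \<comment> \<open>Quality increases with price by \<open>Q_mono\<close>, so buyers of dearer pairs
    have higher types.\<close>
  have crossing: "m \<le> m'" if "m \<in> C i" "m' \<in> C j" "i < j" "j < n" for i j m m'
  proof -
    have "0 \<le> (m' - m) * (Q j - Q i)"
      using ic[of i j m] ic[of j i m'] that by (simp add: algebra_simps)
    then show ?thesis using Q_mono[OF that(3,4)] by (simp add: zero_le_mult_iff)
  qed
  have T_le: "T k \<le> 1 - F c" if k: "k < n" and c: "\<And>m. m \<in> C k \<Longrightarrow> c \<le> m" for k c
  proof -
    obtain m0 where m0: "m0 \<in> C k" using nonempty[OF k] by blast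
    have "(\<Union>i\<in>{k..<n}. C i) \<subseteq> {c..}"
    proof
      fix m assume "m \<in> (\<Union>i\<in>{k..<n}. C i)"
      then obtain i where "k \<le> i" "i < n" "m \<in> C i" by auto
      moreover have "c \<le> m0" using c m0 by blast
      ultimately have "c \<le> m"
        using c[of m] crossing[OF m0, of m i] by (cases "i = k") auto
      then show "m \<in> {c..}" by simp
    qed
    then show ?thesis
      unfolding T_def measure_atLeast[symmetric] by (intro buyers.finite_measure_mono) auto
  qed
  have unit: "P k / Q k \<in> {0..hi E}" if k: "k < n" for k
  proof -
    obtain m where m: "m \<in> C k" using nonempty[OF k] by blast
    have "P k / Q k \<le> m" using ir[OF k m] Q_pos[OF k] by (simp add: field_simps)
    then show ?thesis using types[OF k m] pos[OF k] Q_pos[OF k] by auto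
  qed
  \<comment> \<open>In the induction all buyers of indices above \<open>k\<close> are charged only
    \<open>P k\<close>; passing to \<open>Suc k\<close> adds the increment on the mass
    \<open>T (Suc k)\<close>.\<close>
  have "(\<Sum>i\<le>k. P i * ?\<mu> (C i)) + P k * T (Suc k) \<le> Q k * R (P k / Q k)"
    using \<open>k < n\<close>
  proof (induction k)
    case 0
    have "P 0 * T 0 \<le> P 0 * (1 - F (P 0 / Q 0))"
      using 0 ir[OF 0] Q_pos[OF 0] pos[OF 0]
      by (intro mult_left_mono T_le) (auto simp: field_simps)
    also have "\<dots> = Q 0 * R (P 0 / Q 0)" using Q_pos[OF 0] by (simp add: R_def)
    finally show ?case using T_rec[OF 0] by (simp add: algebra_simps)
  next
    case (Suc k)
    define dP dQ where "dP = P (Suc k) - P k" and "dQ = Q (Suc k) - Q k"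
    have d: "0 < dP" "0 < dQ" using mono Q_mono Suc.prems by (auto simp: dP_def dQ_def)
    have cut: "dP / dQ \<le> m" if "m \<in> C (Suc k)" for m
    proof -
      have "dP \<le> m * dQ"
        using ic[OF Suc.prems _ that, of k] Suc.prems by (simp add: dP_def dQ_def algebra_simps)
      then show ?thesis using d by (simp add: field_simps)
    qed
    obtain m where m: "m \<in> C (Suc k)" using nonempty[OF Suc.prems] by blast
    have dunit: "dP / dQ \<in> {0..hi E}"
      using cut[OF m] types[OF Suc.prems m] d by auto
    have "(\<Sum>i\<le>Suc k. P i * ?\<mu> (C i)) + P (Suc k) * T (Suc (Suc k))
        = ((\<Sum>i\<le>k. P i * ?\<mu> (C i)) + P k * T (Suc k)) + dP * T (Suc k)"
      using T_rec[OF Suc.prems] by (simp add: dP_def algebra_simps)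
    also have "\<dots> \<le> Q k * R (P k / Q k) + dP * (1 - F (dP / dQ))"
      using Suc d cut by (intro add_mono mult_left_mono T_le) auto
    also have "\<dots> = Q k * R (P k / Q k) + dQ * R (dP / dQ)"
      using d by (simp add: R_def)
    also have "\<dots> \<le> (Q k + dQ) * R ((P k + dP) / (Q k + dQ))"
      using Suc.prems d dunit unit[of k] Q_pos[of k] by (intro R_perspective) auto
    finally show ?case by (simp add: dP_def dQ_def)
  qed
  then show ?thesis by (simp add: T_def)
qed

text \<open>The index is that of the highest price; \<open>sorted_menu_revenue\<close> applies once
  the sets are ordered by price.\<close>

lemma implementable_revenue_le:
  assumes "implementable E I p"
  obtains i where "i < length I" "revenue E I p \<le> p ! i * (1 - F (p ! i / q (I ! i)))"
proof -
  define n where "n = length I"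
  have "I \<noteq> []" using assms by (simp add: implementable_def info_structure_def)
  then have n: "0 < n" by (simp add: n_def)
  define xs where "xs = sort_key (\<lambda>i. p ! i) [0..<n]"
  have xs: "distinct xs" "set xs = {..<n}" "length xs = n" "sorted (map (\<lambda>i. p ! i) xs)"
    by (simp_all add: xs_def lessThan_atLeast0)
  define \<sigma> where "\<sigma> i = xs ! i" for i
  have \<sigma>: "bij_betw \<sigma> {..<n} {..<n}"
    unfolding \<sigma>_def by (rule bij_betw_nth) (simp_all add: xs)
  have \<sigma>_less: "\<sigma> i < n" if "i < n" for i
    using bij_betwE[OF \<sigma>] that by simp
  have \<sigma>_inj: "\<sigma> i \<noteq> \<sigma> j" if "i < n" "j < n" "i \<noteq> j" for i j
    using inj_on_eq_iff[OF bij_betw_imp_inj_on[OF \<sigma>]] that by simp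
  have mono: "p ! \<sigma> i < p ! \<sigma> j" if "i < j" "j < n" for i j
  proof -
    have "p ! \<sigma> i \<le> p ! \<sigma> j"
      using xs that sorted_nth_mono[OF xs(4), of i j] by (simp add: \<sigma>_def)
    moreover have "p ! \<sigma> i \<noteq> p ! \<sigma> j"
      using implementable_price_inj[OF assms, of "\<sigma> i" "\<sigma> j"] \<sigma>_less[of i] \<sigma>_less[of j]
        \<sigma>_inj[of i j] that unfolding n_def by auto
    ultimately show ?thesis by simp
  qed
  let ?C = "customers I p"
  have disj: "?C i \<inter> ?C j = {}" if "i < n" "j < n" "i \<noteq> j" for i j
  proof -
    have "m \<notin> ?C b" if "a < b" "b < n" "m \<in> ?C a" for a b m
    proof
      assume "m \<in> ?C b"
      then have "util I p a m \<le> util I p b m" using that by (simp add: customers_def n_def)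
      moreover have "util I p b m \<le> util I p a m" "util I p b m \<noteq> util I p a m"
        using that by (simp_all add: customers_def n_def)
      ultimately show False by simp
    qed
    then show ?thesis using that by (metis disjoint_iff linorder_neqE_nat)
  qed
  have pos: "0 < p ! i" if "i < n" for i using assms that by (simp add: implementable_def n_def)
  \<comment> \<open>At the last position the tail is empty and the sum is the whole revenue.\<close>
  define k where "k = n - 1"
  have k: "k < n" "{..k} = {..<n}" "{Suc k..<n} = {}" using n by (auto simp: k_def)
  have "(\<Sum>i\<le>k. p ! \<sigma> i * measure (buyers E) (?C (\<sigma> i)))
      + p ! \<sigma> k * measure (buyers E) (\<Union>i\<in>{Suc k..<n}. ?C (\<sigma> i))
    \<le> q (I ! \<sigma> k) * R (p ! \<sigma> k / q (I ! \<sigma> k))"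
  proof (rule sorted_menu_revenue)
    show "disjoint_family_on (\<lambda>i. ?C (\<sigma> i)) {..<n}"
      using disj \<sigma>_less \<sigma>_inj by (auto simp: disjoint_family_on_def)
    show "?C (\<sigma> i) \<noteq> {}" if "i < n" for i
      using implementable_served[OF assms, of "\<sigma> i"] \<sigma>_less[OF that] by (auto simp: n_def)
    show "m \<in> {0..hi E}" if "i < n" "m \<in> ?C (\<sigma> i)" for i m
      using that lo_nonneg by (auto simp: customers_def)
    show "p ! \<sigma> i \<le> m * q (I ! \<sigma> i)" if "i < n" "m \<in> ?C (\<sigma> i)" for i m
      using that by (auto simp: customers_def util_def)
    show "m * q (I ! \<sigma> j) - p ! \<sigma> j \<le> m * q (I ! \<sigma> i) - p ! \<sigma> i"
      if "i < n" "j < n" "m \<in> ?C (\<sigma> i)" for i j m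
      using that \<sigma>_less[of j] by (auto simp: customers_def util_def n_def)
  qed (use mono pos \<sigma>_less k in auto)
  then have "(\<Sum>i<n. p ! \<sigma> i * measure (buyers E) (?C (\<sigma> i)))
      \<le> q (I ! \<sigma> k) * R (p ! \<sigma> k / q (I ! \<sigma> k))"
    by (simp add: k)
  also have "(\<Sum>i<n. p ! \<sigma> i * measure (buyers E) (?C (\<sigma> i))) = (\<Sum>i<n. p ! i * measure (buyers E) (?C i))"
    by (rule sum.reindex_bij_betw[OF \<sigma>])
  also have "\<dots> = revenue E I p"
    unfolding revenue_def n_def
  proof (rule sum.cong)
    fix i assume "i \<in> {..<length I}"
    then have "supply_of E (I ! i) (p ! i) = measure (buyers E) (?C i)"
      "supply_of E (I ! i) (p ! i) = demand_of E I p i"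
      using implementable_customers(1)[OF assms, of i] assms by (auto simp: implementable_def)
    then show "p ! i * measure (buyers E) (?C i) =
        p ! i * min (demand_of E I p i) (supply_of E (I ! i) (p ! i))"
      by simp
  qed simp
  also have "q (I ! \<sigma> k) * R (p ! \<sigma> k / q (I ! \<sigma> k)) = p ! \<sigma> k * (1 - F (p ! \<sigma> k / q (I ! \<sigma> k)))"
    using implementable_q_pos[OF assms, of "\<sigma> k"] \<sigma>_less k by (simp add: R_def n_def)
  finally show thesis using that[of "\<sigma> k"] \<sigma>_less k by (simp add: n_def)
qed

subsection \<open>One-pair menus and optimality\<close>

text \<open>\<open>chosen_by\<close> retains ties and so contains the customers, who have positive
  mass in equilibrium.\<close>

lemma positive_mass_CQ: "positive_mass E (CQ E) = CQ E"
proof -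
  have "0 < measure (buyers E) (chosen_by E M z)" if "M \<in> CQ E" "z \<in> M" for M z
  proof -
    obtain I p where I: "implementable E I p" "M = induced_menu E I p"
      using \<open>M \<in> CQ E\<close> by (auto simp: CQ_def WQ_def)
    obtain i where i: "i < length I" "z = (p ! i, q (I ! i))"
      using \<open>z \<in> M\<close> by (auto simp: I implementable_menu[OF I(1)])
    have eq: "chosen_by E M z = {m \<in> space borel. m \<in> {lo E..hi E} \<and> 0 \<le> util I p i m \<and>
        (\<forall>j\<in>{..<length I}. util I p j m \<le> util I p i m)}"
      by (auto simp: chosen_by_def I(2) implementable_menu[OF I(1)] i(2) util_def)
    have "chosen_by E M z \<in> sets borel"
      unfolding eq util_def by measurable
    then have "measure (buyers E) (customers I p i) \<le> measure (buyers E) (chosen_by E M z)"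
      by (intro buyers.finite_measure_mono) (auto simp: eq customers_def)
    then show ?thesis using implementable_customers(2)[OF I(1) i(1)] by simp
  qed
  then show ?thesis by (auto simp: positive_mass_def)
qed

text \<open>A longer structure could yield a one-pair menu only if its pairs coincided; distinct
  prices exclude this.\<close>

lemma singleton_CQ_iff: "{(x, y)} \<in> CQ E \<longleftrightarrow> (\<exists>B. ([B], [x]) \<in> WQ E \<and> y = q B)"
proof
  assume "{(x, y)} \<in> CQ E"
  then obtain I p where I: "implementable E I p" and menu: "{(x, y)} = induced_menu E I p"
    by (auto simp: CQ_def WQ_def)
  have "I \<noteq> []" and len: "length p = length I"
    using I by (simp_all add: implementable_def info_structure_def)
  have all: "p ! i = x \<and> q (I ! i) = y" if "i < length I" for i
    using that menu unfolding implementable_menu[OF I] by blast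
  have "\<not> 1 < length I"
    using implementable_price_inj[OF I, of 0 1] all[of 0] all[of 1] by force
  then have "length I = 1" using \<open>I \<noteq> []\<close> by (cases I) auto
  then obtain B r where "I = [B]" "p = [r]" using len by (auto simp: length_Suc_conv)
  then show "\<exists>B. ([B], [x]) \<in> WQ E \<and> y = q B" using I all[of 0] by (auto simp: WQ_def)
next
  assume "\<exists>B. ([B], [x]) \<in> WQ E \<and> y = q B"
  then obtain B where B: "([B], [x]) \<in> WQ E" "y = q B" by blast
  then have "induced_menu E [B] [x] = {(x, y)}"
    using implementable_menu[of "[B]" "[x]"] by (auto simp: WQ_def)
  then show "{(x, y)} \<in> CQ E"
    using B by (auto simp: CQ_def intro!: rev_image_eqI)
qed

lemma singleton_one_pair_iff: "{(x, y)} \<in> one_pair C \<longleftrightarrow> {(x, y)} \<in> C"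
  by (auto simp: one_pair_def)

lemma implementable_single_above:
  assumes "implementable E I p" "i < length I"
  obtains x where "p ! i \<le> x" "([I ! i], [x]) \<in> WQ E"
proof -
  have "cell (I ! i)" "0 < p ! i" using assms info_cell by (auto simp: implementable_def)
  then show thesis
    using that equilibrium_above implementable_q_pos[OF assms] implementable_supply_le[OF assms] by blast
qed

lemma single_price_unique:
  assumes "([B], [x]) \<in> WQ E" "([B], [y]) \<in> WQ E"
  shows "x = y"
proof (rule antisym)
  show "x \<le> y" by (rule equilibrium_below[OF assms(1)]) (use assms(2) in \<open>auto simp: WQ_single_iff\<close>)
  show "y \<le> x" by (rule equilibrium_below[OF assms(2)]) (use assms(1) in \<open>auto simp: WQ_single_iff\<close>)
qed

lemma single_revenue:
  assumes "([B], [x]) \<in> WQ E"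
  shows "revenue E [B] [x] = x * (1 - F (x / q B))"
  using assms by (simp add: WQ_single_iff revenue_def demand_single supply_eq cell_sets)

text \<open>The supply assumption says that supply covers demand at the monopoly price, so the
  equilibrium price cannot exceed it.\<close>

lemma highest_price_le_monopoly:
  assumes "highest_price E B" "([B], [x]) \<in> WQ E"
    and "demand_of E [B] [monopoly_price E B] 0 \<le> supply_of E B (monopoly_price E B)"
  shows "x \<le> peak * q B"
proof -
  have B: "cell B" "0 < q B" using assms(2) by (auto simp: WQ_single_iff)
  then have "0 < peak * q B" using peak_pos by simp
  moreover from this have "1 - F (peak * q B / q B) \<le> (peak * q B) powr (1 / elasticity E) * W B"
    using assms(3) B by (simp add: monopoly_price_eq demand_single supply_eq cell_sets)
  ultimately show ?thesis by (rule equilibrium_below[OF assms(2)])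
qed

text \<open>For (i) the set of the last pair, taken alone, keeps its quality and has at least its
  price. For (ii) a set with the highest price must be an element of the partition, as otherwise its
  best element would be dearer. Several elements may tie for that price, so the assumption covers
  all of them.\<close>

lemma regular_CQ:
  assumes "\<And>B. highest_price E B \<Longrightarrow>
      demand_of E [B] [monopoly_price E B] 0 \<le> supply_of E B (monopoly_price E B)"
  shows "regular E (CQ E)"
  unfolding regular_def positive_mass_CQ singleton_one_pair_iff
proof (intro conjI allI impI)
  fix zs assume zs: "zs \<noteq> [] \<and> sorted (map fst zs) \<and> set zs \<in> CQ E"
  then obtain I p where I: "implementable E I p" and "set zs = induced_menu E I p"
    by (auto simp: CQ_def WQ_def)
  moreover have "last zs \<in> set zs" using zs by simp
  ultimately obtain i where i: "i < length I" "last zs = (p ! i, q (I ! i))"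
    by (auto simp: implementable_menu[OF I])
  then show "\<exists>p q. {(p, q)} \<in> CQ E \<and> fst (last zs) \<le> p \<and> snd (last zs) \<le> q"
    using implementable_single_above[OF I i(1)] by (metis fst_conv order_refl singleton_CQ_iff snd_conv)
next
  fix x y assume *: "{(x, y)} \<in> CQ E \<and> (\<forall>p' q'. {(p', q')} \<in> CQ E \<longrightarrow> p' \<le> x)"
  then obtain B where B: "([B], [x]) \<in> WQ E" "y = q B" by (auto simp: singleton_CQ_iff)
  have max: "x' \<le> x" if "([B'], [x']) \<in> WQ E" for B' x'
    using * that by (metis singleton_CQ_iff)
  obtain A x' where "A \<in> set (parts E)" "([A], [x']) \<in> WQ E" "A = B \<or> x < x'"
    using best_part_equilibrium[OF B(1)] .
  then have "B \<in> set (parts E)" using max by fastforce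
  then have high: "highest_price E B" using B max by (auto simp: highest_price_def)
  then have "x \<le> peak * q B"
    using highest_price_le_monopoly[OF high B(1) assms[OF high]] by simp
  then show "x \<le> pM E y" using B by (simp add: pM_eq WQ_single_iff)
qed

text \<open>If \<open>H\<close> has at least the quality of \<open>B\<close>, it serves itself, as
  it has the highest price. Otherwise the best element of \<open>B\<close> has higher quality than
  \<open>H\<close>, hence a higher monopoly price, while its equilibrium price is at most
  \<open>h\<close>.\<close>

lemma dominated_by_part_below_monopoly:
  assumes H: "highest_price E H" "([H], [h]) \<in> WQ E" "h \<le> peak * q H"
    and B: "([B], [x]) \<in> WQ E"
  obtains A y where "A \<in> set (parts E)" "([A], [y]) \<in> WQ E" "y \<le> peak * q A" "x \<le> y" "q B \<le> q A"
proof -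
  have max: "y \<le> h" if "A \<in> set (parts E)" "([A], [y]) \<in> WQ E" for A y
    using H(1,2) that single_price_unique unfolding highest_price_def by blast
  obtain A y where A: "A \<in> set (parts E)" "([A], [y]) \<in> WQ E" "x \<le> y" "q B \<le> q A"
    using best_part_equilibrium[OF B] by metis
  show thesis
  proof (cases "q B \<le> q H")
    case True
    show thesis
      using that[of H h] H True A max[OF A(1,2)] by (auto simp: highest_price_def)
  next
    case False
    then have "peak * q H \<le> peak * q A" using A peak_pos by (intro mult_left_mono) auto
    then show thesis using that[of A y] A max[OF A(1,2)] H by simp
  qed
qed

section \<open>Revenue maximization\<close>

lemma finite_attains_max:
  fixes f :: "'a \<Rightarrow> 'b::linorder"
  assumes "finite S" "S \<noteq> {}"
  shows "\<exists>x\<in>S. \<forall>y\<in>S. f y \<le> f x"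
proof -
  have "Max (f ` S) \<in> f ` S" using assms by simp
  then obtain x where "x \<in> S" "f x = Max (f ` S)" by auto
  then show ?thesis using assms(1) by (intro bexI[of _ x]) auto
qed

text \<open>It suffices to maximize over the elements priced at or below monopoly: the
  highest-priced pair of any menu bounds its revenue and is dominated by such an element in both
  price and quality.\<close>

lemma optimal_single:
  assumes H: "highest_price E H"
    and "demand_of E [H] [monopoly_price E H] 0 \<le> supply_of E H (monopoly_price E H)"
  obtains A x where "A \<in> set (parts E)" "([A], [x]) \<in> WQ E"
    and "\<And>I p. (I, p) \<in> WQ E \<Longrightarrow> revenue E I p \<le> revenue E [A] [x]"
    and "\<And>p' q'. {(p', q')} \<in> CQ E \<Longrightarrow> (p', q') \<noteq> (x, q A) \<Longrightarrow> p' < x \<or> q' < q A"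
proof -
  obtain h where h: "([H], [h]) \<in> WQ E" using H by (auto simp: highest_price_def)
  have h_le: "h \<le> peak * q H" by (rule highest_price_le_monopoly[OF H h assms(2)])
  note dominated = dominated_by_part_below_monopoly[OF H h h_le]
  define G where "G = {(A, x). A \<in> set (parts E) \<and> ([A], [x]) \<in> WQ E \<and> x \<le> peak * q A}"
  define rev where "rev = (\<lambda>(A, x). revenue E [A] [x])"
  \<comment> \<open>Each element has at most one equilibrium price, so \<open>G\<close> is finite
    and a maximum exists.\<close>
  have "inj_on fst G" using single_price_unique by (auto simp: inj_on_def G_def)
  moreover have "finite (fst ` G)"
    by (rule finite_subset[of _ "set (parts E)"]) (auto simp: G_def)
  ultimately have finG: "finite G" by (simp add: finite_image_iff)
  have "(H, h) \<in> G" using H h h_le by (auto simp: G_def highest_price_def)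
  obtain g where g: "g \<in> G" "\<And>g'. g' \<in> G \<Longrightarrow> rev g' \<le> rev g"
    using finite_attains_max[OF finG, of rev] \<open>(H, h) \<in> G\<close> by blast
  \<comment> \<open>Ties in revenue are broken by \<open>x + q A\<close>, which makes the menu maximal.\<close>
  define G' where "G' = {g' \<in> G. rev g \<le> rev g'}"
  have G': "finite G'" "g \<in> G'" using finG g(1) by (simp_all add: G'_def)
  obtain k where k: "k \<in> G'" "\<And>g'. g' \<in> G' \<Longrightarrow> snd g' + q (fst g') \<le> snd k + q (fst k)"
    using finite_attains_max[OF G'(1), of "\<lambda>g. snd g + q (fst g)"] G'(2) by blast
  obtain A x where Ax: "k = (A, x)" by (cases k)
  have A: "A \<in> set (parts E)" "([A], [x]) \<in> WQ E" using k Ax by (simp_all add: G'_def G_def)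
  have rev_max: "revenue E [B] [y] \<le> revenue E [A] [x]" if "(B, y) \<in> G" for B y
    using g(2)[OF that] k(1) by (simp add: G'_def rev_def Ax)
  have sum_max: "y + q B \<le> x + q A" if "(B, y) \<in> G" "revenue E [A] [x] \<le> revenue E [B] [y]" for B y
  proof -
    have "rev g \<le> rev (B, y)" using k(1) that(2) by (simp add: G'_def rev_def Ax)
    then show ?thesis using k(2)[of "(B, y)"] that(1) by (simp add: G'_def Ax)
  qed
  have single_le: "p * (1 - F (p / q B)) \<le> revenue E [C] [y]"
    if "0 < p" "0 < q B" "p \<le> y" "q B \<le> q C" "y \<le> peak * q C" "([C], [y]) \<in> WQ E" for p B C y
    using that by (simp add: single_revenue single_revenue_mono)
  have opt: "revenue E I p \<le> revenue E [A] [x]" if imp: "implementable E I p" for I p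
  proof -
    obtain i where i: "i < length I" "revenue E I p \<le> p ! i * (1 - F (p ! i / q (I ! i)))"
      using implementable_revenue_le[OF imp] .
    obtain z where z: "p ! i \<le> z" "([I ! i], [z]) \<in> WQ E"
      using implementable_single_above[OF imp i(1)] .
    obtain C y where C: "C \<in> set (parts E)" "([C], [y]) \<in> WQ E" "y \<le> peak * q C" "z \<le> y" "q (I ! i) \<le> q C"
      using dominated[OF z(2)] .
    have "0 < p ! i" using imp i by (simp add: implementable_def)
    then have "p ! i * (1 - F (p ! i / q (I ! i))) \<le> revenue E [C] [y]"
      using implementable_q_pos[OF imp i(1)] C z by (intro single_le) auto
    also have "\<dots> \<le> revenue E [A] [x]" using C by (intro rev_max) (simp add: G_def)
    finally show ?thesis using i by simp
  qed
  \<comment> \<open>A menu with price and quality at least \<open>x\<close> and \<open>q A\<close>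
    leads to a member of \<open>G\<close> with no less revenue and at least that price and quality.
    The tie-breaking sum then forces equality throughout.\<close>
  have maximal: "p' < x \<or> q' < q A" if sg: "{(p', q')} \<in> CQ E" and ne: "(p', q') \<noteq> (x, q A)" for p' q'
  proof (rule ccontr)
    assume "\<not> (p' < x \<or> q' < q A)"
    then have ge: "x \<le> p'" "q A \<le> q'" by auto
    obtain B where B: "([B], [p']) \<in> WQ E" "q' = q B" using sg by (auto simp: singleton_CQ_iff)
    obtain C y where C: "C \<in> set (parts E)" "([C], [y]) \<in> WQ E" "y \<le> peak * q C" "p' \<le> y" "q B \<le> q C"
      using dominated[OF B(1)] .
    have "x * (1 - F (x / q A)) \<le> revenue E [C] [y]"
      using A(2) C ge B by (intro single_le) (auto simp: WQ_single_iff)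
    then have "y + q C \<le> x + q A"
      using C A by (intro sum_max) (auto simp: G_def single_revenue)
    then show False using ge ne C B by simp
  qed
  show thesis
    by (rule that[OF A opt maximal]) (simp_all add: WQ_def)
qed

end

theorem theorem2:
  fixes E :: market and BH :: "real set"
  assumes "quality_market E"
    and "strictly_convex_on {lo E..hi E} (\<lambda>m. type_cdf E m * m)"
    and "highest_price E BH"
    and "\<And>B. highest_price E B \<Longrightarrow>
           supply_of E B (monopoly_price E B) \<ge> demand_of E [B] [monopoly_price E B] 0"
  shows "regular E (CQ E) \<and>
    (\<exists>I p. separating E 1 I \<and>
       is_arg_max (\<lambda>(I, p). revenue E I p) (\<lambda>w. w \<in> WQ E) (I, p) \<and>
       maximal_menu (one_pair (CQ E)) (induced_menu E I p) \<and>
       (\<exists>B\<in>set (parts E). I = [B]))"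
proof -
  interpret convex_goods_market E
    using assms(1,2) by unfold_locales
  show ?thesis
  proof (rule optimal_single[OF assms(3) assms(4)[OF assms(3)]])
    fix A x
    assume A: "A \<in> set (parts E)" "([A], [x]) \<in> WQ E"
      and opt: "\<And>I p. (I, p) \<in> WQ E \<Longrightarrow> revenue E I p \<le> revenue E [A] [x]"
      and maximal: "\<And>p' q'. {(p', q')} \<in> CQ E \<Longrightarrow> (p', q') \<noteq> (x, quality E A) \<Longrightarrow> p' < x \<or> q' < quality E A"
    have menu: "induced_menu E [A] [x] = {(x, quality E A)}"
      using A(2) implementable_menu[of "[A]" "[x]"] by (auto simp: WQ_def)
    have "separating E 1 [A]"
      using A(2) by (simp add: separating_def WQ_def implementable_def)
    moreover have "is_arg_max (\<lambda>(I, p). revenue E I p) (\<lambda>w. w \<in> WQ E) ([A], [x])"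
      using A(2) opt by (auto simp: is_arg_max_linorder)
    moreover have "maximal_menu (one_pair (CQ E)) (induced_menu E [A] [x])"
      unfolding menu maximal_menu_def singleton_one_pair_iff using A(2) maximal
      by (intro exI[of _ x] exI[of _ "quality E A"]) (auto simp: singleton_CQ_iff singleton_one_pair_iff)
    ultimately show ?thesis
      using A(1) regular_CQ[OF assms(4)] by blast
  qed
qed

end
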